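(* Let $A$ and $B$ be Banach algebras and let $\varphi\in\triangle(A)$, $\psi\in\triangle(B)$. Then the projective tensor product $A\hat{\otimes}B$ is $(\varphi\otimes\psi)$-inner amenable if and only if $A$ is $\varphi$-inner amenable and $B$ is $\psi$-inner amenable. In particular, $A\hat{\otimes}B$ is character inner amenable if and only if both $A$ and $B$ are character inner amenable.
   Context: Banach algebras are over $\mathbb{C}$. $\triangle(A)$ denotes the spectrum of $A$, i.e. the set of all nonzero multiplicative linear functionals $\varphi:A\to\mathbb{C}$. For $a,b\in A$ and $f\in A^*$, define $f\cdot a, a\cdot f\in A^*$ by $\langle f\cdot a,b\rangle=\langle f,ab\rangle$ and $\langle a\cdot f,b\rangle=\langle f,ba\rangle$. For $\varphi\in\triangle(A)$, $A$ is called $\varphi$-inner amenable if there exists $m\in A^{**}$ with $m(\varphi)=1$ and $m(f\cdot a)=m(a\cdot f)$ for all $f\in A^*$, $a\in A$. $A$ is called character inner amenable if it is $\varphi$-inner amenable for every $\varphi\in\triangle(A)$. $A\hat{\otimes}B$ is the projective tensor product of Banach algebras, with multiplication determined by $(a\otimes b)(c\otimes d)=ac\otimes bd$. For $f\in A^*$, $g\in B^*$, $f\otimes g\in(A\hat{\otimes}B)^*$ is the functional with $(f\otimes g)(a\otimes b)=f(a)g(b)$. One has $\triangle(A\hat{\otimes}B)=\{\varphi\otimes\psi:\varphi\in\triangle(A),\psi\in\triangle(B)\}$. *)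

theory Defs
  imports "HOL-Analysis.Analysis" "HOL-Library.Multiset"
begin

section \<open>Complex Banach algebras\<close>

class scaleC =
  fixes scaleC :: "complex \<Rightarrow> 'a \<Rightarrow> 'a" (infixr "*\<^sub>C" 75)

class complex_vector = real_vector + scaleC +
  assumes scaleR_scaleC: "r *\<^sub>R x = complex_of_real r *\<^sub>C x"
    and scaleC_add_right: "c *\<^sub>C (x + y) = c *\<^sub>C x + c *\<^sub>C y"
    and scaleC_add_left: "(c + d) *\<^sub>C x = c *\<^sub>C x + d *\<^sub>C x"
    and scaleC_scaleC: "c *\<^sub>C (d *\<^sub>C x) = (c * d) *\<^sub>C x"

text \<open>As \<open>real_normed_algebra\<close> does not include a unit, neither does this class.\<close>

class complex_banach_algebra = complex_vector + real_normed_algebra + banach +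
  assumes norm_scaleC: "norm (c *\<^sub>C x) = cmod c * norm x"
    and mult_scaleC_left: "(c *\<^sub>C x) * y = c *\<^sub>C (x * y)"
    and mult_scaleC_right: "x * (c *\<^sub>C y) = c *\<^sub>C (x * y)"

lemma scaleC_one: "1 *\<^sub>C (x :: 'a::complex_vector) = x"
  by (metis of_real_1 scaleR_one scaleR_scaleC)

lemma scaleC_minus_one: "(- 1) *\<^sub>C (x :: 'a::complex_vector) = - x"
  by (metis of_real_1 of_real_minus scaleR_minus1_left scaleR_scaleC)

lemma scaleC_zero_right: "c *\<^sub>C (0 :: 'a::complex_vector) = 0"
  using scaleC_add_right[of c 0 0] by simp

lemma scaleC_zero_left: "0 *\<^sub>C (x :: 'a::complex_vector) = 0"
  using scaleC_add_left[of 0 0 x] by simp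

lemma scaleC_minus_right: "c *\<^sub>C (- x) = - (c *\<^sub>C (x :: 'a::complex_vector))"
  using scaleC_add_right[of c x "- x"] by (simp add: scaleC_zero_right eq_neg_iff_add_eq_0 add.commute)

section \<open>Dual, bidual and spectrum\<close>

definition linear_functional :: "('a::complex_vector \<Rightarrow> complex) \<Rightarrow> bool" where
  "linear_functional f \<longleftrightarrow>
     (\<forall>x y. f (x + y) = f x + f y) \<and> (\<forall>c x. f (c *\<^sub>C x) = c * f x)"

definition dual :: "('a::complex_banach_algebra \<Rightarrow> complex) set" where
  "dual = {f. linear_functional f \<and> (\<exists>K. \<forall>x. cmod (f x) \<le> K * norm x)}"

text \<open>An element of the bidual is represented by a function that is linear and bounded
  (with respect to the operator norm) on the dual; its values outside the dual are irrelevant.\<close>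

definition bidual :: "(('a::complex_banach_algebra \<Rightarrow> complex) \<Rightarrow> complex) set" where
  "bidual = {m. (\<forall>f\<in>dual. \<forall>g\<in>dual. m (\<lambda>x. f x + g x) = m f + m g)
              \<and> (\<forall>c. \<forall>f\<in>dual. m (\<lambda>x. c * f x) = c * m f)
              \<and> (\<exists>K. \<forall>f\<in>dual. cmod (m f) \<le> K * onorm f)}"

text \<open>Continuity is not part of this definition; it is automatic (see \<open>gelfand_spectrum_subset_dual\<close>).\<close>

definition gelfand_spectrum :: "('a::complex_banach_algebra \<Rightarrow> complex) set" where
  "gelfand_spectrum = {\<phi>. linear_functional \<phi> \<and> (\<forall>a b. \<phi> (a * b) = \<phi> a * \<phi> b) \<and> \<phi> \<noteq> (\<lambda>_. 0)}"

section \<open>Inner amenability\<close>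

definition act_right :: "('a::complex_banach_algebra \<Rightarrow> complex) \<Rightarrow> 'a \<Rightarrow> 'a \<Rightarrow> complex"
    (infixl "\<cdot>\<^sub>r" 70) where
  "f \<cdot>\<^sub>r a = (\<lambda>b. f (a * b))"

definition act_left :: "'a::complex_banach_algebra \<Rightarrow> ('a \<Rightarrow> complex) \<Rightarrow> 'a \<Rightarrow> complex"
    (infixr "\<cdot>\<^sub>l" 70) where
  "a \<cdot>\<^sub>l f = (\<lambda>b. f (b * a))"

definition inner_amenable :: "('a::complex_banach_algebra \<Rightarrow> complex) \<Rightarrow> bool" where
  "inner_amenable \<phi> \<longleftrightarrow>
     (\<exists>m\<in>bidual. m \<phi> = 1 \<and> (\<forall>f\<in>dual. \<forall>a. m (f \<cdot>\<^sub>r a) = m (a \<cdot>\<^sub>l f)))"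

definition character_inner_amenable :: "'a::complex_banach_algebra itself \<Rightarrow> bool" where
  "character_inner_amenable _ \<longleftrightarrow>
     (\<forall>\<phi> :: 'a \<Rightarrow> complex. \<phi> \<in> gelfand_spectrum \<longrightarrow> inner_amenable \<phi>)"

lemma linear_functional_zero: "linear_functional f \<Longrightarrow> f 0 = 0"
  unfolding linear_functional_def by (metis add_cancel_left_left add_0)

lemma linear_functional_minus: "linear_functional f \<Longrightarrow> f (- x) = - f x"
  unfolding linear_functional_def using scaleC_minus_one[of x] by (metis mult_minus1)

lemma linear_functional_diff: "linear_functional f \<Longrightarrow> f (x - y) = f x - f y"
  using linear_functional_minus[of f y] unfolding linear_functional_def
  by (metis diff_conv_add_uminus)

lemma gelfand_spectrum_bound:
  fixes \<phi> :: "'a::complex_banach_algebra \<Rightarrow> complex"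
  assumes "\<phi> \<in> gelfand_spectrum"
  shows "cmod (\<phi> a) \<le> norm a"
proof (rule ccontr)
  assume "\<not> ?thesis"
  hence less: "norm a < cmod (\<phi> a)" by simp
  have lin: "linear_functional \<phi>" and mul: "\<And>a b. \<phi> (a * b) = \<phi> a * \<phi> b"
    using assms by (auto simp: gelfand_spectrum_def)
  have nz: "\<phi> a \<noteq> 0" using less norm_ge_zero[of a] by auto
  define x where "x = inverse (\<phi> a) *\<^sub>C a"
  have px: "\<phi> x = 1"
    using lin nz by (simp add: x_def linear_functional_def)
  have "0 < cmod (\<phi> a)" using nz by simp
  hence nx: "norm x < 1"
    using less unfolding x_def norm_scaleC norm_inverse
    by (simp add: inverse_eq_divide pos_divide_less_eq del: zero_less_norm_iff)
  define p where "p n = ((*) x ^^ n) x" for n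
  have p_Suc: "p (Suc n) = x * p n" for n by (simp add: p_def)
  have np: "norm (p n) \<le> norm x ^ n * norm x" for n
  proof (induction n)
    case 0 show ?case by (simp add: p_def)
  next
    case (Suc n)
    have "norm (p (Suc n)) \<le> norm x * norm (p n)" by (simp add: p_Suc norm_mult_ineq)
    also have "\<dots> \<le> norm x * (norm x ^ n * norm x)" by (intro mult_left_mono Suc) auto
    finally show ?case by (simp add: mult.assoc)
  qed
  have sp: "summable p"
  proof (rule summable_comparison_test)
    show "\<exists>N. \<forall>n\<ge>N. norm (p n) \<le> norm x ^ n * norm x" using np by blast
    show "summable (\<lambda>n. norm x ^ n * norm x)"
      by (intro summable_mult2 summable_geometric) (use nx in auto)
  qed
  define y where "y = suminf p"
  have "x * y = (\<Sum>n. x * p n)" unfolding y_def by (rule suminf_mult[OF sp, symmetric])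
  also have "\<dots> = (\<Sum>n. p (Suc n))" by (simp add: p_Suc)
  also have "\<dots> = y - p 0" unfolding y_def by (rule suminf_split_head[OF sp])
  finally have "y = x + x * y" by (simp add: p_def)
  hence "\<phi> y = \<phi> (x + x * y)" by (rule arg_cong)
  also have "\<dots> = \<phi> x + \<phi> x * \<phi> y"
    using lin by (simp add: linear_functional_def mul)
  finally have "\<phi> y = \<phi> x + \<phi> x * \<phi> y" .
  thus False using px by simp
qed

lemma gelfand_spectrum_subset_dual: "gelfand_spectrum \<subseteq> (dual :: ('a::complex_banach_algebra \<Rightarrow> complex) set)"
proof
  fix \<phi> :: "'a \<Rightarrow> complex" assume "\<phi> \<in> gelfand_spectrum"
  thus "\<phi> \<in> dual"
    using gelfand_spectrum_bound[of \<phi>] unfolding dual_def gelfand_spectrum_def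
    by (auto intro!: exI[of _ 1])
qed

section \<open>The algebraic tensor product\<close>

text \<open>A finite multiset of pairs \<open>(a\<^sub>i, b\<^sub>i)\<close> stands for the formal sum of the \<open>a\<^sub>i \<otimes> b\<^sub>i\<close>. The algebraic
  tensor product is the free commutative monoid on the pairs modulo the congruence generated by
  the bilinearity relations; scalars are absorbed into the factors, so that this monoid quotient
  is already the tensor product of complex vector spaces.\<close>

inductive tensor_eq :: "('a::complex_vector \<times> 'b::complex_vector) multiset \<Rightarrow> ('a \<times> 'b) multiset \<Rightarrow> bool"
  where
    refl: "tensor_eq M M"
  | sym: "tensor_eq M N \<Longrightarrow> tensor_eq N M"
  | trans: "tensor_eq M N \<Longrightarrow> tensor_eq N P \<Longrightarrow> tensor_eq M P"
  | cong: "tensor_eq M N \<Longrightarrow> tensor_eq (M + P) (N + P)"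
  | add_left: "tensor_eq {#(a + a', b)#} {#(a, b), (a', b)#}"
  | add_right: "tensor_eq {#(a, b + b')#} {#(a, b), (a, b')#}"
  | scale: "tensor_eq {#(c *\<^sub>C a, b)#} {#(a, c *\<^sub>C b)#}"
  | zero: "tensor_eq {#(0, b)#} {#}"

lemma tensor_eq_add:
  assumes "tensor_eq M M'" "tensor_eq N N'"
  shows "tensor_eq (M + N) (M' + N')"
  using tensor_eq.cong[OF assms(1), of N] tensor_eq.cong[OF assms(2), of M']
  unfolding add.commute[of _ M'] by (rule tensor_eq.trans)

lemma tensor_eq_map:
  assumes "tensor_eq M N"
    and f: "\<And>x y. f (x + y) = f x + f y" "\<And>c x. f (c *\<^sub>C x) = c *\<^sub>C f x"
    and g: "\<And>x y. g (x + y) = g x + g y" "\<And>c x. g (c *\<^sub>C x) = c *\<^sub>C g x"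
  shows "tensor_eq (image_mset (map_prod f g) M) (image_mset (map_prod f g) N)"
  using assms(1)
proof induction
  case (trans M N P) thus ?case by (blast intro: tensor_eq.trans)
next
  case (zero b)
  have "f 0 = 0" using f(1)[of 0 0] by simp
  thus ?case by (simp add: tensor_eq.zero)
next
  case (sym M N) thus ?case by (blast intro: tensor_eq.sym)
qed (simp_all add: f g tensor_eq.refl tensor_eq.cong tensor_eq.add_left tensor_eq.add_right
       tensor_eq.scale)

definition mset_times ::
    "('a::times \<times> 'b::times) multiset \<Rightarrow> ('a \<times> 'b) multiset \<Rightarrow> ('a \<times> 'b) multiset" where
  "mset_times M N = (\<Sum>(a, b)\<in>#M. image_mset (map_prod ((*) a) ((*) b)) N)"

lemma mset_times_empty [simp]: "mset_times {#} N = {#}"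
  by (simp add: mset_times_def)

lemma mset_times_add_mset [simp]:
  "mset_times (add_mset (a, b) M) N = image_mset (map_prod ((*) a) ((*) b)) N + mset_times M N"
  by (simp add: mset_times_def)

lemma mset_times_add_left: "mset_times (M + M') N = mset_times M N + mset_times M' N"
  by (simp add: mset_times_def)

lemma mset_times_empty_right [simp]: "mset_times M {#} = {#}"
  by (induction M) auto

lemma mset_times_add_right: "mset_times M (N + N') = mset_times M N + mset_times M N'"
  by (induction M) auto

lemma mset_times_single_right:
  "mset_times M {#(c, d)#} = image_mset (map_prod (\<lambda>a. a * c) (\<lambda>b. b * d)) M"
  by (induction M) auto

lemma mset_times_add_mset_right:
  "mset_times M (add_mset (c, d) N)
     = image_mset (map_prod (\<lambda>a. a * c) (\<lambda>b. b * d)) M + mset_times M N"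
  using mset_times_add_right[of M "{#(c, d)#}" N] by (simp add: mset_times_single_right)

lemma mset_times_map_left:
  assumes "\<And>x y. f (x * y) = f x * y" "\<And>x y. g (x * y) = g x * y"
  shows "mset_times (image_mset (map_prod f g) M) N = image_mset (map_prod f g) (mset_times M N)"
  by (induction M) (auto simp: multiset.map_comp assms intro!: image_mset_cong)

lemma mset_times_map_right:
  assumes "\<And>x y. f (x * y) = x * f y" "\<And>x y. g (x * y) = x * g y"
  shows "mset_times M (image_mset (map_prod f g) N) = image_mset (map_prod f g) (mset_times M N)"
  by (induction M) (auto simp: multiset.map_comp assms intro!: image_mset_cong)

lemma mset_times_assoc:
  fixes M :: "('a::semigroup_mult \<times> 'b::semigroup_mult) multiset"
  shows "mset_times (mset_times M N) P = mset_times M (mset_times N P)"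
  by (induction M) (auto simp: mset_times_add_left mset_times_map_left mult.assoc)

lemma tensor_eq_times:
  fixes M :: "('a::complex_banach_algebra \<times> 'b::complex_banach_algebra) multiset"
  assumes "tensor_eq M M'" "tensor_eq N N'"
  shows "tensor_eq (mset_times M N) (mset_times M' N')"
proof (rule tensor_eq.trans)
  show "tensor_eq (mset_times M N) (mset_times M' N)"
  proof (induction N)
    case empty show ?case by (simp add: tensor_eq.refl)
  next
    case (add x N)
    obtain c d where x: "x = (c, d)" by (cases x)
    show ?case unfolding x mset_times_add_mset_right
      by (rule tensor_eq_add[OF tensor_eq_map[OF assms(1)] add])
         (simp_all add: distrib_right mult_scaleC_left)
  qed
  show "tensor_eq (mset_times M' N) (mset_times M' N')"
  proof (induction M')
    case empty show ?case by (simp add: tensor_eq.refl)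
  next
    case (add x M')
    obtain c d where x: "x = (c, d)" by (cases x)
    show ?case unfolding x mset_times_add_mset
      by (rule tensor_eq_add[OF tensor_eq_map[OF assms(2)] add])
         (simp_all add: distrib_left mult_scaleC_right)
  qed
qed

lemma tensor_eq_scale:
  assumes "tensor_eq M N"
  shows "tensor_eq (image_mset (map_prod ((*\<^sub>C) c) id) M) (image_mset (map_prod ((*\<^sub>C) c) id) N)"
  by (rule tensor_eq_map[OF assms]) (simp_all add: scaleC_add_right scaleC_scaleC mult.commute)

lemma tensor_eq_uminus:
  assumes "tensor_eq M N"
  shows "tensor_eq (image_mset (map_prod uminus id) M) (image_mset (map_prod uminus id) N)"
  by (rule tensor_eq_map[OF assms]) (simp_all add: scaleC_minus_right)

lemma tensor_eq_left_minus: "tensor_eq (image_mset (map_prod uminus id) M + M) {#}"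
proof (induction M)
  case empty show ?case by (simp add: tensor_eq.refl)
next
  case (add x M)
  obtain a b where x: "x = (a, b)" by (cases x)
  have "tensor_eq {#(- a, b), (a, b)#} {#(- a + a, b)#}"
    by (intro tensor_eq.sym[OF tensor_eq.add_left])
  also have "{#(- a + a, b)#} = {#(0, b)#}" by simp
  finally have "tensor_eq {#(- a, b), (a, b)#} {#}"
    by (rule tensor_eq.trans) (rule tensor_eq.zero)
  from tensor_eq_add[OF this add] show ?case by (simp add: x add_mset_commute)
qed

lemma image_mset_scale_scale:
  "image_mset (map_prod ((*\<^sub>C) c) id) (image_mset (map_prod ((*\<^sub>C) d) id) M)
     = image_mset (map_prod ((*\<^sub>C) (c * d)) id) M"
  for M :: "('a::complex_vector \<times> 'b) multiset"
  by (induction M) (auto simp: scaleC_scaleC)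

lemma tensor_eq_scale_add:
  "tensor_eq (image_mset (map_prod ((*\<^sub>C) (c + d)) id) M)
     (image_mset (map_prod ((*\<^sub>C) c) id) M + image_mset (map_prod ((*\<^sub>C) d) id) M)"
proof (induction M)
  case empty show ?case by (simp add: tensor_eq.refl)
next
  case (add x M)
  obtain a b where x: "x = (a, b)" by (cases x)
  have "tensor_eq {#((c + d) *\<^sub>C a, b)#} {#(c *\<^sub>C a, b), (d *\<^sub>C a, b)#}"
    unfolding scaleC_add_left by (rule tensor_eq.add_left)
  from tensor_eq_add[OF this add] show ?case by (simp add: x add_mset_commute)
qed

quotient_type (overloaded) ('a, 'b) alg_tensor =
    "('a::complex_banach_algebra \<times> 'b::complex_banach_algebra) multiset" / tensor_eq
  by (rule equivpI)
     (auto intro!: reflpI sympI transpI intro: tensor_eq.refl tensor_eq.sym tensor_eq.trans)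

lift_definition alg_tensor_pure ::
    "'a::complex_banach_algebra \<Rightarrow> 'b::complex_banach_algebra \<Rightarrow> ('a, 'b) alg_tensor"
  is "\<lambda>a b. {#(a, b)#}" .

instantiation alg_tensor :: (complex_banach_algebra, complex_banach_algebra) ring
begin

lift_definition zero_alg_tensor :: "('a, 'b) alg_tensor" is "{#}" .
lift_definition plus_alg_tensor ::
    "('a, 'b) alg_tensor \<Rightarrow> ('a, 'b) alg_tensor \<Rightarrow> ('a, 'b) alg_tensor"
  is "(+)" by (rule tensor_eq_add)
lift_definition uminus_alg_tensor :: "('a, 'b) alg_tensor \<Rightarrow> ('a, 'b) alg_tensor"
  is "image_mset (map_prod uminus id)" by (rule tensor_eq_uminus)
definition minus_alg_tensor ::
    "('a, 'b) alg_tensor \<Rightarrow> ('a, 'b) alg_tensor \<Rightarrow> ('a, 'b) alg_tensor" where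
  "minus_alg_tensor u v = u + - v"
lift_definition times_alg_tensor ::
    "('a, 'b) alg_tensor \<Rightarrow> ('a, 'b) alg_tensor \<Rightarrow> ('a, 'b) alg_tensor"
  is mset_times by (rule tensor_eq_times)

instance
proof
  fix u v w :: "('a, 'b) alg_tensor"
  show "u + v + w = u + (v + w)" by transfer (simp add: add.assoc tensor_eq.refl)
  show "u + v = v + u" by transfer (simp add: add.commute tensor_eq.refl)
  show "0 + u = u" by transfer (simp add: tensor_eq.refl)
  show "- u + u = 0" by transfer (rule tensor_eq_left_minus)
  show "u - v = u + - v" by (simp add: minus_alg_tensor_def)
  show "u * v * w = u * (v * w)" by transfer (simp add: mset_times_assoc tensor_eq.refl)
  show "(u + v) * w = u * w + v * w" by transfer (simp add: mset_times_add_left tensor_eq.refl)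
  show "u * (v + w) = u * v + u * w" by transfer (simp add: mset_times_add_right tensor_eq.refl)
qed

end

instantiation alg_tensor :: (complex_banach_algebra, complex_banach_algebra) complex_vector
begin

lift_definition scaleC_alg_tensor :: "complex \<Rightarrow> ('a, 'b) alg_tensor \<Rightarrow> ('a, 'b) alg_tensor"
  is "\<lambda>c. image_mset (map_prod ((*\<^sub>C) c) id)" by (rule tensor_eq_scale)
definition scaleR_alg_tensor :: "real \<Rightarrow> ('a, 'b) alg_tensor \<Rightarrow> ('a, 'b) alg_tensor" where
  "scaleR_alg_tensor r u = complex_of_real r *\<^sub>C u"

instance
proof
  have add_right: "c *\<^sub>C (u + v) = c *\<^sub>C u + c *\<^sub>C v" for c and u v :: "('a, 'b) alg_tensor"
    by transfer (simp add: tensor_eq.refl)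
  have add_left: "(c + d) *\<^sub>C u = c *\<^sub>C u + d *\<^sub>C u" for c d and u :: "('a, 'b) alg_tensor"
    by transfer (rule tensor_eq_scale_add)
  have scsc: "c *\<^sub>C d *\<^sub>C u = (c * d) *\<^sub>C u" for c d and u :: "('a, 'b) alg_tensor"
    by transfer (simp add: image_mset_scale_scale tensor_eq.refl)
  have one: "1 *\<^sub>C u = u" for u :: "('a, 'b) alg_tensor"
    by transfer (simp add: scaleC_one map_prod_def id_def tensor_eq.refl)
  fix r s :: real and c d :: complex and u v :: "('a, 'b) alg_tensor"
  show "r *\<^sub>R (u + v) = r *\<^sub>R u + r *\<^sub>R v" by (simp add: scaleR_alg_tensor_def add_right)
  show "(r + s) *\<^sub>R u = r *\<^sub>R u + s *\<^sub>R u" by (simp add: scaleR_alg_tensor_def add_left)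
  show "r *\<^sub>R s *\<^sub>R u = (r * s) *\<^sub>R u" by (simp add: scaleR_alg_tensor_def scsc)
  show "1 *\<^sub>R u = u" by (simp add: scaleR_alg_tensor_def one)
  show "r *\<^sub>R u = complex_of_real r *\<^sub>C u" by (simp add: scaleR_alg_tensor_def)
  show "c *\<^sub>C (u + v) = c *\<^sub>C u + c *\<^sub>C v" "(c + d) *\<^sub>C u = c *\<^sub>C u + d *\<^sub>C u"
    "c *\<^sub>C d *\<^sub>C u = (c * d) *\<^sub>C u" by (rule add_right add_left scsc)+
qed

end

lemma alg_tensor_scaleC_times_left: "(c *\<^sub>C u) * v = c *\<^sub>C (u * v)"
  for u v :: "('a::complex_banach_algebra, 'b::complex_banach_algebra) alg_tensor"
  by transfer (simp add: mset_times_map_left mult_scaleC_left tensor_eq.refl)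

lemma alg_tensor_scaleC_times_right: "u * (c *\<^sub>C v) = c *\<^sub>C (u * v)"
  for u v :: "('a::complex_banach_algebra, 'b::complex_banach_algebra) alg_tensor"
  by transfer (simp add: mset_times_map_right mult_scaleC_right tensor_eq.refl)

lemma alg_tensor_pure_times:
  "alg_tensor_pure a b * alg_tensor_pure c d = alg_tensor_pure (a * c) (b * d)"
  by transfer (simp add: tensor_eq.refl)

section \<open>The projective norm\<close>

definition mset_cost :: "('a::real_normed_vector \<times> 'b::real_normed_vector) multiset \<Rightarrow> real" where
  "mset_cost M = (\<Sum>(a, b)\<in>#M. norm a * norm b)"

definition proj_norm ::
    "('a::complex_banach_algebra, 'b::complex_banach_algebra) alg_tensor \<Rightarrow> real" where
  "proj_norm u = (INF M\<in>{M. abs_alg_tensor M = u}. mset_cost M)"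

lemma mset_cost_simps [simp]:
  "mset_cost {#} = 0" "mset_cost (add_mset (a, b) M) = norm a * norm b + mset_cost M"
  "mset_cost (M + N) = mset_cost M + mset_cost N"
  by (simp_all add: mset_cost_def)

lemma mset_cost_nonneg: "0 \<le> mset_cost M"
  by (induction M) auto

lemma mset_cost_scale:
  "mset_cost (image_mset (map_prod ((*\<^sub>C) c) id) M) = cmod c * mset_cost M"
  for M :: "('a::complex_banach_algebra \<times> 'b::complex_banach_algebra) multiset"
  by (induction M) (auto simp: norm_scaleC algebra_simps)

lemma mset_cost_times: "mset_cost (mset_times M N) \<le> mset_cost M * mset_cost N"
  for M :: "('a::complex_banach_algebra \<times> 'b::complex_banach_algebra) multiset"
proof (induction M)
  case empty show ?case by simp
next
  case (add x M)
  obtain a b where x: "x = (a, b)" by (cases x)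
  have "mset_cost (image_mset (map_prod ((*) a) ((*) b)) N) \<le> norm a * norm b * mset_cost N"
  proof (induction N)
    case empty show ?case by simp
  next
    case (add y N)
    obtain c d where y: "y = (c, d)" by (cases y)
    have "norm (a * c) * norm (b * d) \<le> (norm a * norm c) * (norm b * norm d)"
      by (intro mult_mono norm_mult_ineq) auto
    thus ?case using add by (simp add: y algebra_simps)
  qed
  thus ?case using add by (simp add: x algebra_simps)
qed

lemma proj_norm_le: "proj_norm (abs_alg_tensor M) \<le> mset_cost M"
  unfolding proj_norm_def by (rule cINF_lower) (auto intro!: bdd_belowI2[of _ 0] mset_cost_nonneg)

lemma alg_tensor_rep_ex: "\<exists>M. abs_alg_tensor M = u"
  using Quotient3_abs_rep[OF Quotient3_alg_tensor, of u] by (rule exI)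

lemma proj_norm_nonneg: "0 \<le> proj_norm u"
  unfolding proj_norm_def using alg_tensor_rep_ex[of u]
  by (intro cINF_greatest) (auto intro: mset_cost_nonneg)

lemma proj_norm_approx:
  assumes "e > 0"
  obtains M where "abs_alg_tensor M = u" "mset_cost M < proj_norm u + e"
proof -
  have "(INF M\<in>{M. abs_alg_tensor M = u}. mset_cost M) < proj_norm u + e"
    using assms by (simp add: proj_norm_def)
  thus ?thesis using that alg_tensor_rep_ex[of u]
    by (subst (asm) cINF_less_iff) (auto intro!: bdd_belowI2[of _ 0] mset_cost_nonneg)
qed

lemma proj_norm_zero [simp]:
  "proj_norm (0 :: ('a::complex_banach_algebra, 'b::complex_banach_algebra) alg_tensor) = 0"
proof (rule antisym)
  show "proj_norm (0 :: ('a, 'b) alg_tensor) \<le> 0"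
    using proj_norm_le[of "{#} :: ('a \<times> 'b) multiset"] by (simp add: zero_alg_tensor_def)
qed (rule proj_norm_nonneg)

lemma proj_norm_triangle: "proj_norm (u + v) \<le> proj_norm u + proj_norm v"
proof (rule field_le_epsilon)
  fix e :: real assume e: "e > 0"
  obtain M where M: "abs_alg_tensor M = u" "mset_cost M < proj_norm u + e/2"
    using proj_norm_approx[of "e/2" u] e by auto
  obtain N where N: "abs_alg_tensor N = v" "mset_cost N < proj_norm v + e/2"
    using proj_norm_approx[of "e/2" v] e by auto
  have "proj_norm (u + v) \<le> mset_cost (M + N)"
    using proj_norm_le[of "M + N"] M(1) N(1) by (simp add: plus_alg_tensor.abs_eq[symmetric])
  thus "proj_norm (u + v) \<le> proj_norm u + proj_norm v + e" using M N by simp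
qed

lemma proj_norm_times: "proj_norm (u * v) \<le> proj_norm u * proj_norm v"
proof -
  have "proj_norm (u * v) \<le> (proj_norm u + e) * (proj_norm v + e)" if e: "e > 0" for e
  proof -
    obtain M where M: "abs_alg_tensor M = u" "mset_cost M < proj_norm u + e"
      using proj_norm_approx[of e u] e by auto
    obtain N where N: "abs_alg_tensor N = v" "mset_cost N < proj_norm v + e"
      using proj_norm_approx[of e v] e by auto
    have "proj_norm (u * v) \<le> mset_cost (mset_times M N)"
      using proj_norm_le[of "mset_times M N"] M(1) N(1)
      by (simp add: times_alg_tensor.abs_eq[symmetric])
    also have "\<dots> \<le> mset_cost M * mset_cost N" by (rule mset_cost_times)
    also have "\<dots> \<le> (proj_norm u + e) * (proj_norm v + e)"
      using M N e proj_norm_nonneg[of u] by (intro mult_mono mset_cost_nonneg) auto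
    finally show ?thesis .
  qed
  hence ev: "eventually (\<lambda>e. proj_norm (u * v) \<le> (proj_norm u + e) * (proj_norm v + e)) (at_right 0)"
    by (intro eventually_at_rightI[of 0 1]) auto
  have lim: "((\<lambda>e. (proj_norm u + e) * (proj_norm v + e)) \<longlongrightarrow>
      (proj_norm u + 0) * (proj_norm v + 0)) (at_right 0)"
    by (intro tendsto_intros)
  show ?thesis using tendsto_lowerbound[OF lim ev] by simp
qed

lemma proj_norm_scaleC_le: "proj_norm (c *\<^sub>C u) \<le> cmod c * proj_norm u"
proof -
  have "proj_norm (c *\<^sub>C u) \<le> cmod c * (proj_norm u + e)" if e: "e > 0" for e
  proof -
    obtain M where M: "abs_alg_tensor M = u" "mset_cost M < proj_norm u + e"
      using proj_norm_approx[of e u] e by auto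
    have "proj_norm (c *\<^sub>C u) \<le> cmod c * mset_cost M"
      using proj_norm_le[of "image_mset (map_prod ((*\<^sub>C) c) id) M"] M(1)
      by (simp add: scaleC_alg_tensor.abs_eq[symmetric] mset_cost_scale)
    also have "\<dots> \<le> cmod c * (proj_norm u + e)" using M(2) by (intro mult_left_mono) auto
    finally show ?thesis .
  qed
  hence ev: "eventually (\<lambda>e. proj_norm (c *\<^sub>C u) \<le> cmod c * (proj_norm u + e)) (at_right 0)"
    by (intro eventually_at_rightI[of 0 1]) auto
  have lim: "((\<lambda>e. cmod c * (proj_norm u + e)) \<longlongrightarrow> cmod c * (proj_norm u + 0)) (at_right 0)"
    by (intro tendsto_intros)
  show ?thesis using tendsto_lowerbound[OF lim ev] by simp
qed

lemma proj_norm_scaleC: "proj_norm (c *\<^sub>C u) = cmod c * proj_norm u"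
proof (cases "c = 0")
  case True thus ?thesis by (simp add: scaleC_zero_left)
next
  case False
  have "proj_norm u \<le> inverse (cmod c) * proj_norm (c *\<^sub>C u)"
    using proj_norm_scaleC_le[of "inverse c" "c *\<^sub>C u"] False
    by (simp add: scaleC_scaleC scaleC_one norm_inverse)
  hence "cmod c * proj_norm u \<le> proj_norm (c *\<^sub>C u)"
    using False by (simp add: field_simps)
  thus ?thesis using proj_norm_scaleC_le[of c u] by simp
qed

lemma proj_norm_uminus: "proj_norm (- u) = proj_norm u"
  using proj_norm_scaleC[of "-1" u] by (simp add: scaleC_minus_one)

lemma proj_norm_minus_commute: "proj_norm (u - v) = proj_norm (v - u)"
  by (metis minus_diff_eq proj_norm_uminus)

lemma proj_norm_triangle_diff: "\<bar>proj_norm u - proj_norm v\<bar> \<le> proj_norm (u - v)"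
  using proj_norm_triangle[of "u - v" v] proj_norm_triangle[of "v - u" u]
    proj_norm_minus_commute[of u v] by simp

lemma proj_norm_triangle4: "proj_norm (u - w) \<le> proj_norm (u - v) + proj_norm (v - w)"
  using proj_norm_triangle[of "u - v" "v - w"] by simp

section \<open>The projective tensor product\<close>

text \<open>The completion of the algebraic tensor product: Cauchy sequences for \<open>proj_norm\<close> modulo null
  sequences. The construction only needs \<open>proj_norm\<close> to be a seminorm.\<close>

definition proj_Cauchy ::
    "(nat \<Rightarrow> ('a::complex_banach_algebra, 'b::complex_banach_algebra) alg_tensor) \<Rightarrow> bool" where
  "proj_Cauchy X \<longleftrightarrow> (\<forall>e>0. \<exists>N. \<forall>m\<ge>N. \<forall>n\<ge>N. proj_norm (X m - X n) < e)"

definition proj_eq ::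
    "(nat \<Rightarrow> ('a::complex_banach_algebra, 'b::complex_banach_algebra) alg_tensor)
     \<Rightarrow> (nat \<Rightarrow> ('a, 'b) alg_tensor) \<Rightarrow> bool" where
  "proj_eq X Y \<longleftrightarrow> proj_Cauchy X \<and> proj_Cauchy Y \<and> (\<lambda>n. proj_norm (X n - Y n)) \<longlonglongrightarrow> 0"

lemma proj_CauchyD:
  assumes "proj_Cauchy X" "e > 0"
  obtains N where "\<And>m n. m \<ge> N \<Longrightarrow> n \<ge> N \<Longrightarrow> proj_norm (X m - X n) < e"
  using assms unfolding proj_Cauchy_def by blast

lemma proj_Cauchy_const: "proj_Cauchy (\<lambda>_. u)"
  by (simp add: proj_Cauchy_def)

lemma proj_Cauchy_add:
  assumes "proj_Cauchy X" "proj_Cauchy Y"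
  shows "proj_Cauchy (\<lambda>n. X n + Y n)"
  unfolding proj_Cauchy_def
proof (intro allI impI)
  fix e :: real assume e: "e > 0"
  obtain N where N: "\<And>m n. m \<ge> N \<Longrightarrow> n \<ge> N \<Longrightarrow> proj_norm (X m - X n) < e/2"
    using proj_CauchyD[OF assms(1), of "e/2"] e by auto
  obtain N' where N': "\<And>m n. m \<ge> N' \<Longrightarrow> n \<ge> N' \<Longrightarrow> proj_norm (Y m - Y n) < e/2"
    using proj_CauchyD[OF assms(2), of "e/2"] e by auto
  have "proj_norm ((X m + Y m) - (X n + Y n)) < e" if "m \<ge> max N N'" "n \<ge> max N N'" for m n
    using N[of m n] N'[of m n] that proj_norm_triangle[of "X m - X n" "Y m - Y n"]
    by (simp add: algebra_simps)
  thus "\<exists>N. \<forall>m\<ge>N. \<forall>n\<ge>N. proj_norm ((X m + Y m) - (X n + Y n)) < e" by blast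
qed

lemma proj_Cauchy_scaleC:
  assumes "proj_Cauchy X"
  shows "proj_Cauchy (\<lambda>n. c *\<^sub>C X n)"
  unfolding proj_Cauchy_def
proof (intro allI impI)
  fix e :: real assume e: "e > 0"
  have pos: "cmod c + 1 > 0" using norm_ge_zero[of c] by linarith
  obtain N where N: "\<And>m n. m \<ge> N \<Longrightarrow> n \<ge> N \<Longrightarrow> proj_norm (X m - X n) < e / (cmod c + 1)"
    using proj_CauchyD[OF assms(1), of "e / (cmod c + 1)"] e pos by (metis divide_pos_pos)
  have "proj_norm (c *\<^sub>C X m - c *\<^sub>C X n) < e" if "m \<ge> N" "n \<ge> N" for m n
  proof -
    have "c *\<^sub>C X m - c *\<^sub>C X n = c *\<^sub>C (X m - X n)"
      using scaleC_add_right[of c "X m" "- X n"] by (simp add: scaleC_minus_right)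
    hence "proj_norm (c *\<^sub>C X m - c *\<^sub>C X n) = cmod c * proj_norm (X m - X n)"
      by (simp add: proj_norm_scaleC)
    also have "\<dots> \<le> (cmod c + 1) * proj_norm (X m - X n)"
      by (intro mult_right_mono proj_norm_nonneg) auto
    also have "\<dots> < (cmod c + 1) * (e / (cmod c + 1))"
      using N[OF that] pos by (rule mult_strict_left_mono)
    also have "\<dots> = e" using pos by simp
    finally show ?thesis .
  qed
  thus "\<exists>N. \<forall>m\<ge>N. \<forall>n\<ge>N. proj_norm (c *\<^sub>C X m - c *\<^sub>C X n) < e" by blast
qed

lemma proj_Cauchy_norm:
  assumes "proj_Cauchy X"
  shows "convergent (\<lambda>n. proj_norm (X n))"
proof -
  have "Cauchy (\<lambda>n. proj_norm (X n))"
  proof (rule metric_CauchyI)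
    fix e :: real assume "e > 0"
    then obtain N where N: "\<And>m n. m \<ge> N \<Longrightarrow> n \<ge> N \<Longrightarrow> proj_norm (X m - X n) < e"
      using proj_CauchyD[OF assms] by blast
    have "dist (proj_norm (X m)) (proj_norm (X n)) < e" if "m \<ge> N" "n \<ge> N" for m n
      using N[OF that] proj_norm_triangle_diff[of "X m" "X n"] by (simp add: dist_real_def)
    thus "\<exists>M. \<forall>m\<ge>M. \<forall>n\<ge>M. dist (proj_norm (X m)) (proj_norm (X n)) < e" by blast
  qed
  thus ?thesis by (rule Cauchy_convergent)
qed

lemma proj_Cauchy_bounded:
  assumes "proj_Cauchy X"
  obtains K where "K > 0" "\<And>n. proj_norm (X n) \<le> K"
proof -
  have "Bseq (\<lambda>n. proj_norm (X n))"
    by (rule convergent_imp_Bseq[OF proj_Cauchy_norm[OF assms]])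
  then obtain K where "K > 0" "\<And>n. norm (proj_norm (X n)) \<le> K" by (auto elim: BseqE)
  thus ?thesis using that[of K] by (auto simp: proj_norm_nonneg)
qed

lemma proj_norm_times_diff:
  "proj_norm (u * v - u' * v') \<le> proj_norm (u - u') * proj_norm v + proj_norm u' * proj_norm (v - v')"
proof -
  have "u * v - u' * v' = (u - u') * v + u' * (v - v')" by (simp add: algebra_simps)
  thus ?thesis
    using proj_norm_triangle[of "(u - u') * v" "u' * (v - v')"]
      proj_norm_times[of "u - u'" v] proj_norm_times[of u' "v - v'"] by simp
qed

lemma proj_Cauchy_times:
  assumes "proj_Cauchy X" "proj_Cauchy Y"
  shows "proj_Cauchy (\<lambda>n. X n * Y n)"
  unfolding proj_Cauchy_def
proof (intro allI impI)
  fix e :: real assume e: "e > 0"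
  obtain K where K: "K > 0" "\<And>n. proj_norm (X n) \<le> K" using proj_Cauchy_bounded[OF assms(1)] by blast
  obtain L where L: "L > 0" "\<And>n. proj_norm (Y n) \<le> L" using proj_Cauchy_bounded[OF assms(2)] by blast
  obtain N where N: "\<And>m n. m \<ge> N \<Longrightarrow> n \<ge> N \<Longrightarrow> proj_norm (X m - X n) < e / (2 * L)"
    using proj_CauchyD[OF assms(1), of "e / (2 * L)"] e L by auto
  obtain N' where N': "\<And>m n. m \<ge> N' \<Longrightarrow> n \<ge> N' \<Longrightarrow> proj_norm (Y m - Y n) < e / (2 * K)"
    using proj_CauchyD[OF assms(2), of "e / (2 * K)"] e K by auto
  have "proj_norm (X m * Y m - X n * Y n) < e" if "m \<ge> max N N'" "n \<ge> max N N'" for m n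
  proof -
    have "proj_norm (X m - X n) * proj_norm (Y m) \<le> proj_norm (X m - X n) * L"
      by (intro mult_left_mono L proj_norm_nonneg)
    also have "\<dots> < e / (2 * L) * L" using N[of m n] that L by (intro mult_strict_right_mono) auto
    also have "\<dots> = e / 2" using L by simp
    finally have 1: "proj_norm (X m - X n) * proj_norm (Y m) < e / 2" .
    have "proj_norm (X n) * proj_norm (Y m - Y n) \<le> K * proj_norm (Y m - Y n)"
      by (intro mult_right_mono K proj_norm_nonneg)
    also have "\<dots> < K * (e / (2 * K))" using N'[of m n] that K by (intro mult_strict_left_mono) auto
    also have "\<dots> = e / 2" using K by simp
    finally have 2: "proj_norm (X n) * proj_norm (Y m - Y n) < e / 2" .
    show ?thesis using proj_norm_times_diff[of "X m" "Y m" "X n" "Y n"] 1 2 by linarith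
  qed
  thus "\<exists>N. \<forall>m\<ge>N. \<forall>n\<ge>N. proj_norm (X m * Y m - X n * Y n) < e" by blast
qed

lemma proj_null_comparison:
  assumes "\<And>n. proj_norm (X n) \<le> f n" "f \<longlonglongrightarrow> 0"
  shows "(\<lambda>n. proj_norm (X n)) \<longlonglongrightarrow> 0"
  by (rule tendsto_sandwich[OF _ _ tendsto_const assms(2)]) (auto simp: proj_norm_nonneg assms(1))

lemma proj_eq_refl: "proj_Cauchy X \<Longrightarrow> proj_eq X X"
  by (simp add: proj_eq_def)

lemma proj_eq_add:
  assumes "proj_eq X X'" "proj_eq Y Y'"
  shows "proj_eq (\<lambda>n. X n + Y n) (\<lambda>n. X' n + Y' n)"
proof -
  have "(\<lambda>n. proj_norm ((X n + Y n) - (X' n + Y' n))) \<longlonglongrightarrow> 0"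
  proof (rule proj_null_comparison)
    show "proj_norm ((X n + Y n) - (X' n + Y' n)) \<le> proj_norm (X n - X' n) + proj_norm (Y n - Y' n)"
      for n using proj_norm_triangle[of "X n - X' n" "Y n - Y' n"] by (simp add: algebra_simps)
    show "(\<lambda>n. proj_norm (X n - X' n) + proj_norm (Y n - Y' n)) \<longlonglongrightarrow> 0"
      using assms unfolding proj_eq_def by (auto intro!: tendsto_add_zero)
  qed
  thus ?thesis using assms by (auto simp: proj_eq_def intro!: proj_Cauchy_add)
qed

lemma proj_eq_scaleC:
  assumes "proj_eq X X'"
  shows "proj_eq (\<lambda>n. c *\<^sub>C X n) (\<lambda>n. c *\<^sub>C X' n)"
proof -
  have eq: "c *\<^sub>C X n - c *\<^sub>C X' n = c *\<^sub>C (X n - X' n)" for n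
    using scaleC_add_right[of c "X n" "- X' n"] by (simp add: scaleC_minus_right)
  have "(\<lambda>n. proj_norm (c *\<^sub>C X n - c *\<^sub>C X' n)) \<longlonglongrightarrow> 0"
    unfolding eq proj_norm_scaleC
    using assms unfolding proj_eq_def by (auto intro!: tendsto_mult_right_zero)
  thus ?thesis using assms by (auto simp: proj_eq_def intro!: proj_Cauchy_scaleC)
qed

lemma proj_eq_uminus:
  assumes "proj_eq X X'"
  shows "proj_eq (\<lambda>n. - X n) (\<lambda>n. - X' n)"
  using proj_eq_scaleC[OF assms, of "-1"] by (simp add: scaleC_minus_one)

lemma proj_eq_times:
  assumes "proj_eq X X'" "proj_eq Y Y'"
  shows "proj_eq (\<lambda>n. X n * Y n) (\<lambda>n. X' n * Y' n)"
proof -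
  have C: "proj_Cauchy X" "proj_Cauchy X'" "proj_Cauchy Y" "proj_Cauchy Y'"
    using assms by (auto simp: proj_eq_def)
  obtain K where K: "K > 0" "\<And>n. proj_norm (X' n) \<le> K" using proj_Cauchy_bounded[OF C(2)] by blast
  obtain L where L: "L > 0" "\<And>n. proj_norm (Y n) \<le> L" using proj_Cauchy_bounded[OF C(3)] by blast
  have "(\<lambda>n. proj_norm (X n * Y n - X' n * Y' n)) \<longlonglongrightarrow> 0"
  proof (rule proj_null_comparison)
    fix n
    have "proj_norm (X n - X' n) * proj_norm (Y n) \<le> proj_norm (X n - X' n) * L"
      by (intro mult_left_mono L proj_norm_nonneg)
    moreover have "proj_norm (X' n) * proj_norm (Y n - Y' n) \<le> K * proj_norm (Y n - Y' n)"
      by (intro mult_right_mono K proj_norm_nonneg)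
    ultimately show "proj_norm (X n * Y n - X' n * Y' n)
        \<le> proj_norm (X n - X' n) * L + K * proj_norm (Y n - Y' n)"
      using proj_norm_times_diff[of "X n" "Y n" "X' n" "Y' n"] by linarith
  next
    show "(\<lambda>n. proj_norm (X n - X' n) * L + K * proj_norm (Y n - Y' n)) \<longlonglongrightarrow> 0"
      using assms unfolding proj_eq_def
      by (auto intro!: tendsto_add_zero tendsto_mult_right_zero tendsto_mult_left_zero)
  qed
  thus ?thesis using C by (auto simp: proj_eq_def intro!: proj_Cauchy_times)
qed

lemma proj_eq_norm:
  assumes "proj_eq X X'"
  shows "lim (\<lambda>n. proj_norm (X n)) = lim (\<lambda>n. proj_norm (X' n))"
proof -
  have "(\<lambda>n. proj_norm (X n)) \<longlonglongrightarrow> lim (\<lambda>n. proj_norm (X n))"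
    "(\<lambda>n. proj_norm (X' n)) \<longlonglongrightarrow> lim (\<lambda>n. proj_norm (X' n))"
    using assms proj_Cauchy_norm by (auto simp: proj_eq_def convergent_LIMSEQ_iff)
  hence "(\<lambda>n. proj_norm (X n) - proj_norm (X' n))
      \<longlonglongrightarrow> lim (\<lambda>n. proj_norm (X n)) - lim (\<lambda>n. proj_norm (X' n))" by (rule tendsto_diff)
  moreover have "(\<lambda>n. proj_norm (X n) - proj_norm (X' n)) \<longlonglongrightarrow> 0"
  proof (rule Lim_null_comparison)
    show "\<forall>\<^sub>F n in sequentially. norm (proj_norm (X n) - proj_norm (X' n)) \<le> proj_norm (X n - X' n)"
      by (simp add: proj_norm_triangle_diff)
    show "(\<lambda>n. proj_norm (X n - X' n)) \<longlonglongrightarrow> 0" using assms by (simp add: proj_eq_def)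
  qed
  ultimately show ?thesis using LIMSEQ_unique by fastforce
qed

quotient_type (overloaded) ('a, 'b) proj_tensor =
    "nat \<Rightarrow> ('a::complex_banach_algebra, 'b::complex_banach_algebra) alg_tensor" / partial: proj_eq
proof (rule part_equivpI)
  show "\<exists>X :: nat \<Rightarrow> ('a, 'b) alg_tensor. proj_eq X X"
    using proj_eq_refl proj_Cauchy_const by blast
  show "symp (proj_eq :: (nat \<Rightarrow> ('a, 'b) alg_tensor) \<Rightarrow> _)"
    by (rule sympI) (simp add: proj_eq_def proj_norm_minus_commute)
  show "transp (proj_eq :: (nat \<Rightarrow> ('a, 'b) alg_tensor) \<Rightarrow> _)"
  proof (rule transpI)
    fix X Y Z :: "nat \<Rightarrow> ('a, 'b) alg_tensor"
    assume 1: "proj_eq X Y" and 2: "proj_eq Y Z"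
    have "(\<lambda>n. proj_norm (X n - Z n)) \<longlonglongrightarrow> 0"
    proof (rule proj_null_comparison)
      show "proj_norm (X n - Z n) \<le> proj_norm (X n - Y n) + proj_norm (Y n - Z n)" for n
        by (rule proj_norm_triangle4)
      show "(\<lambda>n. proj_norm (X n - Y n) + proj_norm (Y n - Z n)) \<longlonglongrightarrow> 0"
        using 1 2 unfolding proj_eq_def by (auto intro!: tendsto_add_zero)
    qed
    thus "proj_eq X Z" using 1 2 by (simp add: proj_eq_def)
  qed
qed

(* otherwise the next definition would be lifted through both quotients *)
lifting_forget alg_tensor.lifting

lemma proj_eq_iff: "proj_eq X Y \<longleftrightarrow> proj_Cauchy X \<and> proj_Cauchy Y \<and> abs_proj_tensor X = abs_proj_tensor Y"
  using Quotient3_rel[OF Quotient3_proj_tensor, of X Y] proj_eq_refl[of X] proj_eq_refl[of Y]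
  by (auto simp: proj_eq_def)

lift_definition of_alg_tensor ::
    "('a::complex_banach_algebra, 'b::complex_banach_algebra) alg_tensor \<Rightarrow> ('a, 'b) proj_tensor"
  is "\<lambda>u _. u" by (rule proj_eq_refl[OF proj_Cauchy_const])

definition tensor ::
    "'a::complex_banach_algebra \<Rightarrow> 'b::complex_banach_algebra \<Rightarrow> ('a, 'b) proj_tensor"
    (infixr "\<otimes>" 75) where
  "a \<otimes> b = of_alg_tensor (alg_tensor_pure a b)"

instantiation proj_tensor :: (complex_banach_algebra, complex_banach_algebra) ring
begin

lift_definition zero_proj_tensor :: "('a, 'b) proj_tensor" is "\<lambda>_. 0"
  by (rule proj_eq_refl[OF proj_Cauchy_const])
lift_definition plus_proj_tensor ::
    "('a, 'b) proj_tensor \<Rightarrow> ('a, 'b) proj_tensor \<Rightarrow> ('a, 'b) proj_tensor"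
  is "\<lambda>X Y n. X n + Y n" by (rule proj_eq_add)
lift_definition uminus_proj_tensor :: "('a, 'b) proj_tensor \<Rightarrow> ('a, 'b) proj_tensor"
  is "\<lambda>X n. - X n" by (rule proj_eq_uminus)
definition minus_proj_tensor ::
    "('a, 'b) proj_tensor \<Rightarrow> ('a, 'b) proj_tensor \<Rightarrow> ('a, 'b) proj_tensor" where
  "minus_proj_tensor U V = U + - V"
lift_definition times_proj_tensor ::
    "('a, 'b) proj_tensor \<Rightarrow> ('a, 'b) proj_tensor \<Rightarrow> ('a, 'b) proj_tensor"
  is "\<lambda>X Y n. X n * Y n" by (rule proj_eq_times)

instance
proof
  fix U V W :: "('a, 'b) proj_tensor"
  show "U + V + W = U + (V + W)"
    by transfer (auto simp: add.assoc intro!: proj_eq_add)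
  show "U + V = V + U"
    by transfer (auto simp: add.commute intro!: proj_eq_add)
  show "0 + U = U" by transfer simp
  show "- U + U = 0"
    by transfer (auto intro!: proj_eq_refl proj_Cauchy_const)
  show "U - V = U + - V" by (simp add: minus_proj_tensor_def)
  show "U * V * W = U * (V * W)"
    by transfer (auto simp: mult.assoc intro!: proj_eq_times)
  show "(U + V) * W = U * W + V * W"
    by transfer (auto simp: distrib_right intro!: proj_eq_add proj_eq_times)
  show "U * (V + W) = U * V + U * W"
    by transfer (auto simp: distrib_left intro!: proj_eq_add proj_eq_times)
qed

end

lemma minus_proj_tensor_abs:
  assumes "proj_eq X X" "proj_eq Y Y"
  shows "abs_proj_tensor X - abs_proj_tensor Y = abs_proj_tensor (\<lambda>n. X n - Y n)"
proof -
  have "proj_eq (\<lambda>n. - Y n) (\<lambda>n. - Y n)" by (rule proj_eq_uminus[OF assms(2)])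
  thus ?thesis using assms
    by (simp add: minus_proj_tensor_def uminus_proj_tensor.abs_eq plus_proj_tensor.abs_eq)
qed

instantiation proj_tensor :: (complex_banach_algebra, complex_banach_algebra) complex_vector
begin

lift_definition scaleC_proj_tensor :: "complex \<Rightarrow> ('a, 'b) proj_tensor \<Rightarrow> ('a, 'b) proj_tensor"
  is "\<lambda>c X n. c *\<^sub>C X n" by (rule proj_eq_scaleC)
definition scaleR_proj_tensor :: "real \<Rightarrow> ('a, 'b) proj_tensor \<Rightarrow> ('a, 'b) proj_tensor" where
  "scaleR_proj_tensor r U = complex_of_real r *\<^sub>C U"

instance
proof
  have add_right: "c *\<^sub>C (U + V) = c *\<^sub>C U + c *\<^sub>C V" for c and U V :: "('a, 'b) proj_tensor"
    by transfer (auto simp: scaleC_add_right intro!: proj_eq_add proj_eq_scaleC)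
  have add_left: "(c + d) *\<^sub>C U = c *\<^sub>C U + d *\<^sub>C U" for c d and U :: "('a, 'b) proj_tensor"
    by transfer (auto simp: scaleC_add_left intro!: proj_eq_add proj_eq_scaleC)
  have scsc: "c *\<^sub>C d *\<^sub>C U = (c * d) *\<^sub>C U" for c d and U :: "('a, 'b) proj_tensor"
    by transfer (auto simp: scaleC_scaleC intro!: proj_eq_scaleC)
  have one: "1 *\<^sub>C U = U" for U :: "('a, 'b) proj_tensor"
    by transfer (simp add: scaleC_one)
  fix r s :: real and c d :: complex and U V :: "('a, 'b) proj_tensor"
  show "r *\<^sub>R (U + V) = r *\<^sub>R U + r *\<^sub>R V" by (simp add: scaleR_proj_tensor_def add_right)
  show "(r + s) *\<^sub>R U = r *\<^sub>R U + s *\<^sub>R U" by (simp add: scaleR_proj_tensor_def add_left)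
  show "r *\<^sub>R s *\<^sub>R U = (r * s) *\<^sub>R U" by (simp add: scaleR_proj_tensor_def scsc)
  show "1 *\<^sub>R U = U" by (simp add: scaleR_proj_tensor_def one)
  show "r *\<^sub>R U = complex_of_real r *\<^sub>C U" by (simp add: scaleR_proj_tensor_def)
  show "c *\<^sub>C (U + V) = c *\<^sub>C U + c *\<^sub>C V" "(c + d) *\<^sub>C U = c *\<^sub>C U + d *\<^sub>C U"
    "c *\<^sub>C d *\<^sub>C U = (c * d) *\<^sub>C U" by (rule add_right add_left scsc)+
qed

end

lemma proj_tensor_scaleC_times_left: "(c *\<^sub>C U) * V = c *\<^sub>C (U * V)"
  for U V :: "('a::complex_banach_algebra, 'b::complex_banach_algebra) proj_tensor"
  by transfer (auto simp: alg_tensor_scaleC_times_left intro!: proj_eq_scaleC proj_eq_times)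

lemma proj_tensor_scaleC_times_right: "U * (c *\<^sub>C V) = c *\<^sub>C (U * V)"
  for U V :: "('a::complex_banach_algebra, 'b::complex_banach_algebra) proj_tensor"
  by transfer (auto simp: alg_tensor_scaleC_times_right intro!: proj_eq_scaleC proj_eq_times)

lemma proj_tensor_cases:
  obtains X where "U = abs_proj_tensor X" "proj_Cauchy X" "proj_eq X X"
proof -
  obtain X where "proj_eq X X" "abs_proj_tensor X = U"
    using Quotient3_abs_rep[OF Quotient3_proj_tensor, of U]
      Quotient3_rep_reflp[OF Quotient3_proj_tensor, of U] by blast
  thus ?thesis using that by (auto simp: proj_eq_def)
qed

instantiation proj_tensor :: (complex_banach_algebra, complex_banach_algebra) real_normed_algebra
begin

lift_definition norm_proj_tensor :: "('a, 'b) proj_tensor \<Rightarrow> real"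
  is "\<lambda>X. lim (\<lambda>n. proj_norm (X n))" by (rule proj_eq_norm)
definition dist_proj_tensor :: "('a, 'b) proj_tensor \<Rightarrow> ('a, 'b) proj_tensor \<Rightarrow> real" where
  "dist_proj_tensor U V = norm (U - V)"
definition sgn_proj_tensor :: "('a, 'b) proj_tensor \<Rightarrow> ('a, 'b) proj_tensor" where
  "sgn_proj_tensor U = inverse (norm U) *\<^sub>R U"
definition uniformity_proj_tensor :: "(('a, 'b) proj_tensor \<times> ('a, 'b) proj_tensor) filter" where
  "uniformity_proj_tensor = (INF e\<in>{0<..}. principal {(U, V). dist U V < e})"
definition open_proj_tensor :: "('a, 'b) proj_tensor set \<Rightarrow> bool" where
  "open_proj_tensor S \<longleftrightarrow> (\<forall>U\<in>S. \<forall>\<^sub>F (U', V) in uniformity. U' = U \<longrightarrow> V \<in> S)"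

lemma norm_proj_tensor_tendsto:
  fixes X :: "nat \<Rightarrow> ('a, 'b) alg_tensor"
  assumes "proj_Cauchy X"
  shows "(\<lambda>n. proj_norm (X n)) \<longlonglongrightarrow> norm (abs_proj_tensor X)"
  using proj_Cauchy_norm[OF assms] proj_eq_refl[OF assms]
  by (simp add: norm_proj_tensor.abs_eq convergent_LIMSEQ_iff)

lemma norm_scaleC_proj_tensor: "norm (c *\<^sub>C U) = cmod c * norm U" for U :: "('a, 'b) proj_tensor"
proof -
  obtain X where U: "U = abs_proj_tensor X" and C: "proj_Cauchy X" and E: "proj_eq X X"
    by (rule proj_tensor_cases)
  have "(\<lambda>n. cmod c * proj_norm (X n)) \<longlonglongrightarrow> norm (c *\<^sub>C U)"
    using norm_proj_tensor_tendsto[OF proj_Cauchy_scaleC[OF C, of c]] E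
    by (simp add: U scaleC_proj_tensor.abs_eq proj_norm_scaleC)
  moreover have "(\<lambda>n. cmod c * proj_norm (X n)) \<longlonglongrightarrow> cmod c * norm U"
    unfolding U by (intro tendsto_intros norm_proj_tensor_tendsto C)
  ultimately show ?thesis by (rule LIMSEQ_unique)
qed

instance
proof
  fix U V :: "('a, 'b) proj_tensor" and r :: real
  obtain X where U: "U = abs_proj_tensor X" and X: "proj_Cauchy X" "proj_eq X X"
    by (rule proj_tensor_cases)
  obtain Y where V: "V = abs_proj_tensor Y" and Y: "proj_Cauchy Y" "proj_eq Y Y"
    by (rule proj_tensor_cases)
  note lims = norm_proj_tensor_tendsto[OF X(1), folded U] norm_proj_tensor_tendsto[OF Y(1), folded V]
  show "dist U V = norm (U - V)" by (rule dist_proj_tensor_def)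
  show "sgn U = inverse (norm U) *\<^sub>R U" by (rule sgn_proj_tensor_def)
  show "uniformity = (INF e\<in>{0<..}. principal {(U, V :: ('a, 'b) proj_tensor). dist U V < e})"
    by (rule uniformity_proj_tensor_def)
  show "open S \<longleftrightarrow> (\<forall>U\<in>S. \<forall>\<^sub>F (U', V) in uniformity. U' = U \<longrightarrow> V \<in> S)"
    for S :: "('a, 'b) proj_tensor set" by (rule open_proj_tensor_def)
  show "norm U = 0 \<longleftrightarrow> U = 0"
  proof
    assume "norm U = 0"
    hence "proj_eq X (\<lambda>_. 0)"
      using lims(1) X by (simp add: proj_eq_def proj_Cauchy_const)
    thus "U = 0" by (simp add: U zero_proj_tensor_def proj_eq_iff)
  next
    assume "U = 0"
    hence "proj_eq X (\<lambda>_. 0)"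
      using X by (simp add: U zero_proj_tensor_def proj_eq_iff proj_Cauchy_const)
    hence "(\<lambda>n. proj_norm (X n)) \<longlonglongrightarrow> 0" by (simp add: proj_eq_def)
    thus "norm U = 0" using lims(1) by (rule LIMSEQ_unique[rotated])
  qed
  show "norm (U + V) \<le> norm U + norm V"
  proof (rule LIMSEQ_le)
    show "(\<lambda>n. proj_norm (X n + Y n)) \<longlonglongrightarrow> norm (U + V)"
      using norm_proj_tensor_tendsto[OF proj_Cauchy_add[OF X(1) Y(1)]] X Y
      by (simp add: U V plus_proj_tensor.abs_eq)
    show "(\<lambda>n. proj_norm (X n) + proj_norm (Y n)) \<longlonglongrightarrow> norm U + norm V"
      by (intro tendsto_add lims)
    show "\<exists>N. \<forall>n\<ge>N. proj_norm (X n + Y n) \<le> proj_norm (X n) + proj_norm (Y n)"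
      using proj_norm_triangle by blast
  qed
  show "norm (U * V) \<le> norm U * norm V"
  proof (rule LIMSEQ_le)
    show "(\<lambda>n. proj_norm (X n * Y n)) \<longlonglongrightarrow> norm (U * V)"
      using norm_proj_tensor_tendsto[OF proj_Cauchy_times[OF X(1) Y(1)]] X Y
      by (simp add: U V times_proj_tensor.abs_eq)
    show "(\<lambda>n. proj_norm (X n) * proj_norm (Y n)) \<longlonglongrightarrow> norm U * norm V"
      by (intro tendsto_mult lims)
    show "\<exists>N. \<forall>n\<ge>N. proj_norm (X n * Y n) \<le> proj_norm (X n) * proj_norm (Y n)"
      using proj_norm_times by blast
  qed
  show "norm (r *\<^sub>R U) = \<bar>r\<bar> * norm U"
    by (simp add: scaleR_scaleC norm_scaleC_proj_tensor)
  show "r *\<^sub>R U * V = r *\<^sub>R (U * V)" "U * r *\<^sub>R V = r *\<^sub>R (U * V)"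
    by (simp_all add: scaleR_scaleC proj_tensor_scaleC_times_left proj_tensor_scaleC_times_right)
qed

end

lemma norm_of_alg_tensor: "norm (of_alg_tensor u) = proj_norm u"
  by transfer simp

lemma of_alg_tensor_add: "of_alg_tensor (u + v) = of_alg_tensor u + of_alg_tensor v"
  by transfer (simp add: proj_eq_refl proj_Cauchy_const)

lemma of_alg_tensor_zero: "of_alg_tensor 0 = 0"
  by transfer (simp add: proj_eq_refl proj_Cauchy_const)

lemma of_alg_tensor_scaleC: "of_alg_tensor (c *\<^sub>C u) = c *\<^sub>C of_alg_tensor u"
  by transfer (simp add: proj_eq_refl proj_Cauchy_const)

lemma of_alg_tensor_times: "of_alg_tensor (u * v) = of_alg_tensor u * of_alg_tensor v"
  by transfer (simp add: proj_eq_refl proj_Cauchy_const)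

lemma of_alg_tensor_diff: "of_alg_tensor (u - v) = of_alg_tensor u - of_alg_tensor v"
  using of_alg_tensor_add[of "u - v" v] by simp

lemma proj_tensor_limit:
  assumes X: "proj_Cauchy X"
  shows "(\<lambda>n. of_alg_tensor (X n)) \<longlonglongrightarrow> abs_proj_tensor X"
proof (rule metric_LIMSEQ_I)
  fix e :: real assume e: "e > 0"
  obtain N where N: "\<And>m n. m \<ge> N \<Longrightarrow> n \<ge> N \<Longrightarrow> proj_norm (X m - X n) < e/2"
    using proj_CauchyD[OF X, of "e/2"] e by auto
  have "dist (of_alg_tensor (X n)) (abs_proj_tensor X) < e" if n: "n \<ge> N" for n
  proof -
    have C: "proj_Cauchy (\<lambda>k. X k - X n)"
      using proj_Cauchy_add[OF X proj_Cauchy_const, of "- X n"] by simp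
    have "abs_proj_tensor X - of_alg_tensor (X n) = abs_proj_tensor (\<lambda>k. X k - X n)"
      using minus_proj_tensor_abs[OF proj_eq_refl[OF X] proj_eq_refl[OF proj_Cauchy_const[of "X n"]]]
      by (simp add: of_alg_tensor.abs_eq)
    hence "(\<lambda>k. proj_norm (X k - X n)) \<longlonglongrightarrow> norm (abs_proj_tensor X - of_alg_tensor (X n))"
      using norm_proj_tensor_tendsto[OF C] by simp
    hence "norm (abs_proj_tensor X - of_alg_tensor (X n)) \<le> e/2"
      by (rule LIMSEQ_le_const2) (use N n in \<open>auto intro!: exI[of _ N] less_imp_le\<close>)
    thus ?thesis using e by (simp add: dist_norm norm_minus_commute)
  qed
  thus "\<exists>N. \<forall>n\<ge>N. dist (of_alg_tensor (X n)) (abs_proj_tensor X) < e" by blast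
qed

lemma of_alg_tensor_dense:
  assumes "e > 0"
  obtains u where "norm (U - of_alg_tensor u) < e"
proof -
  obtain X where U: "U = abs_proj_tensor X" and X: "proj_Cauchy X" by (rule proj_tensor_cases)
  obtain N where "dist (of_alg_tensor (X N)) U < e"
    using metric_LIMSEQ_D[OF proj_tensor_limit[OF X] assms] unfolding U by blast
  thus ?thesis using that[of "X N"] by (simp add: dist_norm norm_minus_commute)
qed

instance proj_tensor :: (complex_banach_algebra, complex_banach_algebra) banach
proof
  fix U :: "nat \<Rightarrow> ('a, 'b) proj_tensor" assume U: "Cauchy U"
  have "\<exists>u. norm (U n - of_alg_tensor u) < inverse (real (Suc n))" for n
    using of_alg_tensor_dense[of "inverse (real (Suc n))" "U n"] by auto
  then obtain u where u: "\<And>n. norm (U n - of_alg_tensor (u n)) < inverse (real (Suc n))" by metis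
  have lim0: "(\<lambda>n. U n - of_alg_tensor (u n)) \<longlonglongrightarrow> 0"
    by (rule Lim_null_comparison[OF _ LIMSEQ_inverse_real_of_nat])
       (use u less_imp_le in \<open>fastforce intro!: always_eventually\<close>)
  have C: "Cauchy (\<lambda>n. of_alg_tensor (u n))"
  proof (rule metric_CauchyI)
    fix e :: real assume e: "e > 0"
    obtain N where N: "\<And>m n. m \<ge> N \<Longrightarrow> n \<ge> N \<Longrightarrow> dist (U m) (U n) < e/3"
      using metric_CauchyD[OF U, of "e/3"] e by auto
    obtain N' where N': "\<And>n. n \<ge> N' \<Longrightarrow> norm (U n - of_alg_tensor (u n)) < e/3"
      using LIMSEQ_D[OF lim0, of "e/3"] e by auto
    have "dist (of_alg_tensor (u m)) (of_alg_tensor (u n)) < e" if "m \<ge> max N N'" "n \<ge> max N N'" for m n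
    proof -
      have "dist (U m) (of_alg_tensor (u m)) < e/3" "dist (U n) (of_alg_tensor (u n)) < e/3"
        "dist (U m) (U n) < e/3" using N[of m n] N'[of m] N'[of n] that by (auto simp: dist_norm)
      thus ?thesis
        using dist_triangle[of "of_alg_tensor (u m)" "of_alg_tensor (u n)" "U m"]
          dist_triangle[of "U m" "of_alg_tensor (u n)" "U n"]
        by (simp add: dist_commute)
    qed
    thus "\<exists>M. \<forall>m\<ge>M. \<forall>n\<ge>M. dist (of_alg_tensor (u m)) (of_alg_tensor (u n)) < e" by blast
  qed
  have "proj_Cauchy u"
    unfolding proj_Cauchy_def
    using C unfolding Cauchy_def dist_norm of_alg_tensor_diff[symmetric] norm_of_alg_tensor .
  from tendsto_add[OF lim0 proj_tensor_limit[OF this]] show "convergent U"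
    by (auto simp: convergent_def)
qed

instance proj_tensor :: (complex_banach_algebra, complex_banach_algebra) complex_banach_algebra
  by standard (rule norm_scaleC_proj_tensor proj_tensor_scaleC_times_left
      proj_tensor_scaleC_times_right)+

lemma tensor_times: "(a \<otimes> b) * (c \<otimes> d) = (a * c) \<otimes> (b * d)"
  by (simp add: tensor_def of_alg_tensor_times[symmetric] alg_tensor_pure_times)

lemma norm_tensor_le: "norm (a \<otimes> b) \<le> norm a * norm b"
  using proj_norm_le[of "{#(a, b)#}"]
  by (simp add: tensor_def norm_of_alg_tensor alg_tensor_pure.abs_eq)

lemma of_alg_tensor_sum:
  "of_alg_tensor (abs_alg_tensor M) = (\<Sum>(a, b)\<in>#M. a \<otimes> b)"
proof (induction M)
  case empty
  show ?case using of_alg_tensor_zero by (simp add: zero_alg_tensor_def)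
next
  case (add x M)
  obtain a b where x: "x = (a, b)" by (cases x)
  have "abs_alg_tensor (add_mset (a, b) M) = alg_tensor_pure a b + abs_alg_tensor M"
    by (simp add: alg_tensor_pure.abs_eq plus_alg_tensor.abs_eq)
  thus ?case using add by (simp add: x of_alg_tensor_add tensor_def)
qed

section \<open>Functionals on the projective tensor product\<close>

definition bounded_bilinear_form ::
    "('a::complex_banach_algebra \<Rightarrow> 'b::complex_banach_algebra \<Rightarrow> complex) \<Rightarrow> bool" where
  "bounded_bilinear_form F \<longleftrightarrow>
     (\<forall>b. linear_functional (\<lambda>a. F a b)) \<and> (\<forall>a. linear_functional (F a))
     \<and> (\<exists>K. \<forall>a b. cmod (F a b) \<le> K * (norm a * norm b))"

lemma tensor_eq_bilinear:
  assumes F: "\<And>b. linear_functional (\<lambda>a. F a b)" "\<And>a. linear_functional (F a)"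
    and "tensor_eq M N"
  shows "(\<Sum>(a, b)\<in>#M. F a b) = (\<Sum>(a, b)\<in>#N. F a b)"
  using assms(3)
proof induction
  case (zero b) thus ?case using linear_functional_zero[OF F(1)] by simp
qed (use F in \<open>auto simp: linear_functional_def\<close>)

lemma dual_tendsto:
  assumes "h \<in> dual" "X \<longlonglongrightarrow> x"
  shows "(\<lambda>n. h (X n)) \<longlonglongrightarrow> h x"
proof -
  obtain K where lin: "linear_functional h" and K: "\<And>x. cmod (h x) \<le> K * norm x"
    using assms(1) by (auto simp: dual_def)
  have "(\<lambda>n. norm (X n - x)) \<longlonglongrightarrow> 0"
    by (rule tendsto_norm_zero[OF LIM_zero[OF assms(2)]])
  hence "(\<lambda>n. K * norm (X n - x)) \<longlonglongrightarrow> 0" by (rule tendsto_mult_right_zero)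
  hence "(\<lambda>n. h (X n) - h x) \<longlonglongrightarrow> 0"
    by (rule Lim_null_comparison[rotated])
       (auto simp: linear_functional_diff[OF lin, symmetric] K)
  thus ?thesis by (rule LIM_zero_cancel)
qed

lemma dual_tensor_eqI:
  fixes h :: "('a::complex_banach_algebra, 'b::complex_banach_algebra) proj_tensor \<Rightarrow> complex"
  assumes "h \<in> dual" "h' \<in> dual" "\<And>a b. h (a \<otimes> b) = h' (a \<otimes> b)"
  shows "h = h'"
proof
  fix U :: "('a, 'b) proj_tensor"
  have alg: "h (of_alg_tensor u) = h' (of_alg_tensor u)" for u :: "('a, 'b) alg_tensor"
  proof -
    obtain M where M: "u = abs_alg_tensor M" using alg_tensor_rep_ex[of u] by auto
    have "linear_functional h" "linear_functional h'" using assms by (auto simp: dual_def)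
    hence "h (\<Sum>(a, b)\<in>#M. a \<otimes> b) = h' (\<Sum>(a, b)\<in>#M. a \<otimes> b)"
      by (induction M)
         (auto simp: linear_functional_zero, auto simp: linear_functional_def assms(3))
    thus ?thesis by (simp add: M of_alg_tensor_sum)
  qed
  obtain X where U: "U = abs_proj_tensor X" and X: "proj_Cauchy X" by (rule proj_tensor_cases)
  have "(\<lambda>n. h (of_alg_tensor (X n))) \<longlonglongrightarrow> h U" "(\<lambda>n. h (of_alg_tensor (X n))) \<longlonglongrightarrow> h' U"
    unfolding U using dual_tendsto[OF assms(1) proj_tensor_limit[OF X]]
      dual_tendsto[OF assms(2) proj_tensor_limit[OF X]] by (simp_all add: alg)
  thus "h U = h' U" by (rule LIMSEQ_unique)
qed

lemma bilinear_lift: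
  fixes F :: "'a::complex_banach_algebra \<Rightarrow> 'b::complex_banach_algebra \<Rightarrow> complex"
  assumes "bounded_bilinear_form F"
  shows "\<exists>!h. h \<in> dual \<and> (\<forall>a b. h (a \<otimes> b) = F a b)"
proof -
  obtain K0 where F: "\<And>b. linear_functional (\<lambda>a. F a b)" "\<And>a. linear_functional (F a)"
    and K0: "\<And>a b. cmod (F a b) \<le> K0 * (norm a * norm b)"
    using assms by (auto simp: bounded_bilinear_form_def)
  define K where "K = max K0 0"
  have "K \<ge> 0" by (simp add: K_def)
  have K: "cmod (F a b) \<le> K * (norm a * norm b)" for a b
    using K0[of a b] by (rule order_trans) (auto simp: K_def intro!: mult_right_mono)
  define s where "s M = (\<Sum>(a, b)\<in>#M. F a b)" for M
  define L where "L u = s (SOME M. abs_alg_tensor M = u)" for u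
  have L: "L (abs_alg_tensor M) = s M" for M
  proof -
    have "abs_alg_tensor (SOME N. abs_alg_tensor N = abs_alg_tensor M) = abs_alg_tensor M"
      by (rule someI) (rule HOL.refl)
    thus ?thesis unfolding L_def s_def alg_tensor.abs_eq_iff by (rule tensor_eq_bilinear[OF F])
  qed
  have L_add: "L (u + v) = L u + L v" for u v
  proof -
    obtain M N where MN: "u = abs_alg_tensor M" "v = abs_alg_tensor N"
      using alg_tensor_rep_ex[of u] alg_tensor_rep_ex[of v] by auto
    show ?thesis by (simp add: MN plus_alg_tensor.abs_eq L) (simp add: s_def)
  qed
  have L_scale: "L (c *\<^sub>C u) = c * L u" for c u
  proof -
    obtain M where M: "u = abs_alg_tensor M" using alg_tensor_rep_ex[of u] by auto
    have "s (image_mset (map_prod ((*\<^sub>C) c) id) M) = c * s M"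
      unfolding s_def using F(1) by (induction M) (auto simp: linear_functional_def algebra_simps)
    thus ?thesis by (simp add: M scaleC_alg_tensor.abs_eq L)
  qed
  have s_bound: "cmod (s M) \<le> K * mset_cost M" for M
  proof (induction M)
    case empty show ?case by (simp add: s_def)
  next
    case (add x M)
    obtain a b where x: "x = (a, b)" by (cases x)
    have "cmod (s (add_mset x M)) \<le> cmod (F a b) + cmod (s M)"
      by (simp add: s_def x norm_triangle_ineq)
    thus ?case using add K[of a b] by (simp add: x algebra_simps)
  qed
  have L_bound: "cmod (L u) \<le> K * proj_norm u" for u
  proof -
    have "cmod (L u) \<le> K * (proj_norm u + e)" if e: "e > 0" for e
    proof -
      obtain M where M: "abs_alg_tensor M = u" "mset_cost M < proj_norm u + e"
        using proj_norm_approx[of e u] e by auto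
      have "cmod (L u) \<le> K * mset_cost M" using s_bound[of M] M(1) L[of M] by simp
      also have "\<dots> \<le> K * (proj_norm u + e)" using M(2) \<open>K \<ge> 0\<close> by (intro mult_left_mono) auto
      finally show ?thesis .
    qed
    hence ev: "eventually (\<lambda>e. cmod (L u) \<le> K * (proj_norm u + e)) (at_right 0)"
      by (intro eventually_at_rightI[of 0 1]) auto
    have lim: "((\<lambda>e. K * (proj_norm u + e)) \<longlongrightarrow> K * (proj_norm u + 0)) (at_right 0)"
      by (intro tendsto_intros)
    show ?thesis using tendsto_lowerbound[OF lim ev] by simp
  qed
  have L_diff: "L (u - v) = L u - L v" for u v
    using L_add[of "u - v" v] by simp
  define h where "h U = lim (\<lambda>n. L (rep_proj_tensor U n))" for U
  have rep: "proj_Cauchy (rep_proj_tensor U)" "abs_proj_tensor (rep_proj_tensor U) = U"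
    for U :: "('a, 'b) proj_tensor"
    using Quotient3_abs_rep[OF Quotient3_proj_tensor, of U]
      Quotient3_rep_reflp[OF Quotient3_proj_tensor, of U] by (auto simp: proj_eq_def)
  have L_conv: "convergent (\<lambda>n. L (X n))" if X: "proj_Cauchy X" for X
  proof -
    have "Cauchy (\<lambda>n. L (X n))"
    proof (rule metric_CauchyI)
      fix e :: real assume e: "e > 0"
      have pos: "e / (K + 1) > 0" using e \<open>K \<ge> 0\<close> by simp
      obtain N where N: "\<And>m n. m \<ge> N \<Longrightarrow> n \<ge> N \<Longrightarrow> proj_norm (X m - X n) < e / (K + 1)"
        using proj_CauchyD[OF X pos] by blast
      have "dist (L (X m)) (L (X n)) < e" if "m \<ge> N" "n \<ge> N" for m n
      proof -
        have "dist (L (X m)) (L (X n)) \<le> K * proj_norm (X m - X n)"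
          using L_bound[of "X m - X n"] by (simp add: L_diff dist_norm)
        also have "\<dots> \<le> (K + 1) * proj_norm (X m - X n)"
          by (intro mult_right_mono proj_norm_nonneg) auto
        also have "\<dots> < (K + 1) * (e / (K + 1))"
          using N[OF that] \<open>K \<ge> 0\<close> by (intro mult_strict_left_mono) auto
        also have "\<dots> = e" using \<open>K \<ge> 0\<close> by simp
        finally show ?thesis .
      qed
      thus "\<exists>M. \<forall>m\<ge>M. \<forall>n\<ge>M. dist (L (X m)) (L (X n)) < e" by blast
    qed
    thus ?thesis by (rule Cauchy_convergent)
  qed
  have h_lim: "(\<lambda>n. L (X n)) \<longlonglongrightarrow> h (abs_proj_tensor X)" if X: "proj_Cauchy X" for X
  proof -
    define Y where "Y = rep_proj_tensor (abs_proj_tensor X)"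
    have eq: "proj_eq X Y"
      using rep[of "abs_proj_tensor X"] X by (simp add: Y_def proj_eq_iff)
    have Y: "(\<lambda>n. L (Y n)) \<longlonglongrightarrow> h (abs_proj_tensor X)"
      using L_conv[OF rep(1)[of "abs_proj_tensor X"]]
      by (simp add: h_def Y_def convergent_LIMSEQ_iff)
    have "(\<lambda>n. K * proj_norm (X n - Y n)) \<longlonglongrightarrow> 0"
      using eq by (auto simp: proj_eq_def intro!: tendsto_mult_right_zero)
    hence "(\<lambda>n. L (X n) - L (Y n)) \<longlonglongrightarrow> 0"
      by (rule Lim_null_comparison[rotated]) (use L_bound in \<open>auto simp: L_diff[symmetric]\<close>)
    from tendsto_add[OF this Y] show ?thesis by simp
  qed
  have h_alg: "h (of_alg_tensor u) = L u" for u
    using h_lim[OF proj_Cauchy_const[of u]] by (simp add: of_alg_tensor.abs_eq LIMSEQ_const_iff)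
  have "linear_functional h"
    unfolding linear_functional_def
  proof safe
    fix U V :: "('a, 'b) proj_tensor" and c
    obtain X where U: "U = abs_proj_tensor X" and X: "proj_Cauchy X" "proj_eq X X"
      by (rule proj_tensor_cases)
    obtain Y where V: "V = abs_proj_tensor Y" and Y: "proj_Cauchy Y" "proj_eq Y Y"
      by (rule proj_tensor_cases)
    have "(\<lambda>n. L (X n) + L (Y n)) \<longlonglongrightarrow> h (U + V)"
      using h_lim[OF proj_Cauchy_add[OF X(1) Y(1)]] X Y
      by (simp add: U V plus_proj_tensor.abs_eq L_add)
    moreover have "(\<lambda>n. L (X n) + L (Y n)) \<longlonglongrightarrow> h U + h V"
      unfolding U V by (intro tendsto_add h_lim X Y)
    ultimately show "h (U + V) = h U + h V" by (rule LIMSEQ_unique)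
    have "(\<lambda>n. c * L (X n)) \<longlonglongrightarrow> h (c *\<^sub>C U)"
      using h_lim[OF proj_Cauchy_scaleC[OF X(1), of c]] X
      by (simp add: U scaleC_proj_tensor.abs_eq L_scale)
    moreover have "(\<lambda>n. c * L (X n)) \<longlonglongrightarrow> c * h U"
      unfolding U by (intro tendsto_intros h_lim X)
    ultimately show "h (c *\<^sub>C U) = c * h U" by (rule LIMSEQ_unique)
  qed
  moreover have "cmod (h U) \<le> K * norm U" for U
  proof -
    obtain X where U: "U = abs_proj_tensor X" and X: "proj_Cauchy X" by (rule proj_tensor_cases)
    show ?thesis unfolding U
    proof (rule LIMSEQ_le)
      show "(\<lambda>n. cmod (L (X n))) \<longlonglongrightarrow> cmod (h (abs_proj_tensor X))"
        by (intro tendsto_norm h_lim X)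
      show "(\<lambda>n. K * proj_norm (X n)) \<longlonglongrightarrow> K * norm (abs_proj_tensor X)"
        by (intro tendsto_intros norm_proj_tensor_tendsto X)
      show "\<exists>N. \<forall>n\<ge>N. cmod (L (X n)) \<le> K * proj_norm (X n)" using L_bound by blast
    qed
  qed
  ultimately have "h \<in> dual" by (auto simp: dual_def)
  moreover have "h (a \<otimes> b) = F a b" for a b
    using L[of "{#(a, b)#}"] by (simp add: tensor_def h_alg alg_tensor_pure.abs_eq s_def)
  ultimately show ?thesis by (auto intro!: ex1I[of _ h] dual_tensor_eqI)
qed

definition tensor_functional ::
    "('a::complex_banach_algebra \<Rightarrow> complex) \<Rightarrow> ('b::complex_banach_algebra \<Rightarrow> complex)
     \<Rightarrow> ('a, 'b) proj_tensor \<Rightarrow> complex" (infixr "\<otimes>\<^sub>f" 75) where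
  "f \<otimes>\<^sub>f g = (THE h. h \<in> dual \<and> (\<forall>a b. h (a \<otimes> b) = f a * g b))"

lemma tensor_functional:
  assumes "f \<in> dual" "g \<in> dual"
  shows "f \<otimes>\<^sub>f g \<in> dual" "(f \<otimes>\<^sub>f g) (a \<otimes> b) = f a * g b"
proof -
  obtain K L where lin: "linear_functional f" "linear_functional g"
    and K: "\<And>a. cmod (f a) \<le> K * norm a" and L: "\<And>b. cmod (g b) \<le> L * norm b"
    using assms by (auto simp: dual_def)
  have "cmod (f a * g b) \<le> (K * L) * (norm a * norm b)" for a b
  proof -
    have "cmod (f a * g b) \<le> (K * norm a) * (L * norm b)"
      unfolding norm_mult using K[of a] L[of b] order_trans[OF norm_ge_zero K[of a]]
      by (intro mult_mono) auto
    thus ?thesis by (simp add: algebra_simps)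
  qed
  hence "bounded_bilinear_form (\<lambda>a b. f a * g b)"
    using lin unfolding bounded_bilinear_form_def
    by (auto simp: linear_functional_def algebra_simps intro!: exI[of _ "K * L"])
  from theI'[OF bilinear_lift[OF this]]
  show "f \<otimes>\<^sub>f g \<in> dual" "(f \<otimes>\<^sub>f g) (a \<otimes> b) = f a * g b"
    by (simp_all add: tensor_functional_def)
qed

end

theory Submission
  imports Defs
begin

text \<open>If \<open>m\<close> witnesses inner amenability of the tensor product at \<open>\<phi> \<otimes> \<psi>\<close>, then
  \<open>f \<mapsto> m (f \<otimes> \<psi>)\<close> does so for \<open>\<phi>\<close>: for \<open>\<psi> b = 1\<close>, the actions of \<open>a \<otimes> b\<close> on
  \<open>f \<otimes> \<psi>\<close> reduce to those of \<open>a\<close> on \<open>f\<close>. Conversely, witnesses \<open>m\<close> and \<open>n\<close> for \<open>\<phi>\<close> and \<open>\<psi>\<close>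
  are combined into the iterated functional \<open>h \<mapsto> m (a \<mapsto> n (b \<mapsto> h (a \<otimes> b)))\<close>;
  invariance is checked on elementary tensors, one variable at a time, and extends to the whole
  tensor product by linearity and continuity. For the second part, a character \<open>h\<close> of the tensor
  product with \<open>h (u \<otimes> v) = 1\<close> factors as \<open>a \<mapsto> h (a u \<otimes> v)\<close> times \<open>b \<mapsto> h (u \<otimes> b v)\<close>.\<close>

section \<open>Dual and bidual\<close>

lemma dual_linear: "f \<in> dual \<Longrightarrow> linear_functional f"
  by (simp add: dual_def)

text \<open>Complex linearity restricts to real linearity, which opens the library facts about
  \<open>onorm\<close> to elements of \<open>dual\<close>.\<close>

lemma bounded_linear_dual:
  assumes "f \<in> dual"
  shows "bounded_linear f"
proof -
  obtain K where lin: "linear_functional f" and K: "\<And>x. cmod (f x) \<le> K * norm x"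
    using assms by (auto simp: dual_def)
  show ?thesis
    by (rule bounded_linear_intro[of f K])
       (use lin K in \<open>auto simp: linear_functional_def scaleR_scaleC scaleR_conv_of_real mult.commute\<close>)
qed

lemma onorm_dual_nonneg: "f \<in> dual \<Longrightarrow> 0 \<le> onorm f"
  by (rule onorm_pos_le[OF bounded_linear_dual])

lemma onorm_dual: "f \<in> dual \<Longrightarrow> cmod (f x) \<le> onorm f * norm x"
  by (rule onorm[OF bounded_linear_dual])

lemma dual_add:
  assumes f: "f \<in> dual" and g: "g \<in> dual"
  shows "(\<lambda>x. f x + g x) \<in> dual"
proof -
  have "cmod (f x + g x) \<le> (onorm f + onorm g) * norm x" for x
    using norm_triangle_ineq[of "f x" "g x"] onorm_dual[OF f, of x] onorm_dual[OF g, of x]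
    by (simp add: algebra_simps)
  moreover have "linear_functional (\<lambda>x. f x + g x)"
    using dual_linear[OF f] dual_linear[OF g] by (simp add: linear_functional_def algebra_simps)
  ultimately show ?thesis unfolding dual_def by blast
qed

lemma dual_scale:
  assumes f: "f \<in> dual"
  shows "(\<lambda>x. c * f x) \<in> dual"
proof -
  have "cmod (c * f x) \<le> (cmod c * onorm f) * norm x" for x
    using mult_left_mono[OF onorm_dual[OF f, of x], of "cmod c"] by (simp add: norm_mult mult.assoc)
  moreover have "linear_functional (\<lambda>x. c * f x)"
    using dual_linear[OF f] by (simp add: linear_functional_def algebra_simps)
  ultimately show ?thesis unfolding dual_def by blast
qed

lemma bidual_add: "m \<in> bidual \<Longrightarrow> f \<in> dual \<Longrightarrow> g \<in> dual \<Longrightarrow> m (\<lambda>x. f x + g x) = m f + m g"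
  and bidual_scale: "m \<in> bidual \<Longrightarrow> f \<in> dual \<Longrightarrow> m (\<lambda>x. c * f x) = c * m f"
  by (simp_all add: bidual_def)

text \<open>For estimates without computing operator norms: any bound \<open>C\<close> for
  \<open>f\<close> may replace \<open>onorm f\<close>, and a constant \<open>K \<ge> 0\<close> lets
  such estimates be chained.\<close>

lemma bidual_bound:
  assumes "m \<in> bidual"
  obtains K where "K \<ge> 0"
    "\<And>f C. f \<in> dual \<Longrightarrow> C \<ge> 0 \<Longrightarrow> (\<And>x. cmod (f x) \<le> C * norm x) \<Longrightarrow> cmod (m f) \<le> K * C"
proof -
  obtain K0 where K0: "\<And>f. f \<in> dual \<Longrightarrow> cmod (m f) \<le> K0 * onorm f"
    using assms unfolding bidual_def by blast
  show thesis
  proof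
    show "max K0 0 \<ge> 0" by simp
    fix f :: "'a \<Rightarrow> complex" and C :: real
    assume f: "f \<in> dual" and C: "C \<ge> 0" and le: "\<And>x. cmod (f x) \<le> C * norm x"
    have "cmod (m f) \<le> K0 * onorm f" by (rule K0[OF f])
    also have "\<dots> \<le> max K0 0 * onorm f"
      using onorm_dual_nonneg[OF f] by (intro mult_right_mono) auto
    also have "\<dots> \<le> max K0 0 * C"
      using onorm_bound[of C f] C le by (intro mult_left_mono) auto
    finally show "cmod (m f) \<le> max K0 0 * C" .
  qed
qed

section \<open>Bounded bilinear forms and their slices\<close>

lemma bounded_bilinear_form_dual:
  assumes "bounded_bilinear_form F"
  shows "F a \<in> dual"
proof -
  obtain K where "\<And>a b. cmod (F a b) \<le> K * (norm a * norm b)"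
    using assms by (auto simp: bounded_bilinear_form_def)
  hence "\<forall>b. cmod (F a b) \<le> (K * norm a) * norm b" by (simp add: mult.assoc)
  thus ?thesis using assms unfolding dual_def bounded_bilinear_form_def by blast
qed

text \<open>The slice \<open>F a\<close> depends linearly on \<open>a\<close> and has norm at most a
  constant times \<open>norm a\<close>; \<open>m\<close> preserves both properties. This allows
  bidual elements to be applied one after the other.\<close>

lemma bidual_bilinear:
  assumes m: "m \<in> bidual" and F: "bounded_bilinear_form F"
  shows "(\<lambda>a. m (F a)) \<in> dual"
proof -
  obtain K where K: "K \<ge> 0" "\<And>f C. f \<in> dual \<Longrightarrow> C \<ge> 0 \<Longrightarrow>
      (\<And>x. cmod (f x) \<le> C * norm x) \<Longrightarrow> cmod (m f) \<le> K * C"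
    using bidual_bound[OF m] by metis
  obtain L where lin: "\<And>b. linear_functional (\<lambda>a. F a b)"
    and L: "\<And>a b. cmod (F a b) \<le> L * (norm a * norm b)"
    using F by (auto simp: bounded_bilinear_form_def)
  note F_dual = bounded_bilinear_form_dual[OF F]
  have "F (x + y) = (\<lambda>b. F x b + F y b)" "F (c *\<^sub>C x) = (\<lambda>b. c * F x b)" for x y c
    using lin by (auto simp: linear_functional_def)
  hence "linear_functional (\<lambda>a. m (F a))"
    using F_dual by (simp add: linear_functional_def bidual_add[OF m] bidual_scale[OF m])
  moreover have "cmod (m (F a)) \<le> (K * max L 0) * norm a" for a
  proof -
    have "cmod (F a b) \<le> (max L 0 * norm a) * norm b" for b
    proof -
      have "L * (norm a * norm b) \<le> max L 0 * (norm a * norm b)" by (intro mult_right_mono) auto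
      thus ?thesis using L[of a b] by (simp add: mult.assoc)
    qed
    from K(2)[OF F_dual _ this] show ?thesis by (simp add: mult.assoc)
  qed
  ultimately show ?thesis unfolding dual_def by blast
qed

lemma bounded_bilinear_form_swap:
  assumes "bounded_bilinear_form F"
  shows "bounded_bilinear_form (\<lambda>b a. F a b)"
  using assms unfolding bounded_bilinear_form_def by (metis mult.commute)

text \<open>Serves for \<open>t\<close> the multiplication of an algebra and for \<open>t\<close>
  the elementary tensor map; as \<open>t\<close> is contractive, \<open>onorm h\<close> is a
  bound.\<close>

lemma bounded_bilinear_form_compose:
  assumes h: "h \<in> dual"
    and add: "\<And>a a' b. t (a + a') b = t a b + t a' b" "\<And>a b b'. t a (b + b') = t a b + t a b'"
    and scale: "\<And>c a b. t (c *\<^sub>C a) b = c *\<^sub>C t a b" "\<And>c a b. t a (c *\<^sub>C b) = c *\<^sub>C t a b"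
    and le: "\<And>a b. norm (t a b) \<le> norm a * norm b"
  shows "bounded_bilinear_form (\<lambda>a b. h (t a b))"
proof -
  have "cmod (h (t a b)) \<le> onorm h * (norm a * norm b)" for a b
    using onorm_dual[OF h, of "t a b"] mult_left_mono[OF le onorm_dual_nonneg[OF h]]
    by (rule order_trans)
  thus ?thesis using dual_linear[OF h] unfolding bounded_bilinear_form_def
    by (auto simp: linear_functional_def add scale)
qed

lemma bounded_bilinear_form_times:
  "h \<in> dual \<Longrightarrow> bounded_bilinear_form (\<lambda>a b. h (a * b))"
  by (rule bounded_bilinear_form_compose)
     (simp_all add: distrib_left distrib_right mult_scaleC_left mult_scaleC_right norm_mult_ineq)

text \<open>Needed when invariance in the first variable is applied after \<open>b\<close> has been
  moved to the right in the second.\<close>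

lemma bounded_bilinear_form_times_right:
  assumes "bounded_bilinear_form F"
  shows "bounded_bilinear_form (\<lambda>x y. F x (y * b))"
proof -
  obtain K where lin: "\<And>y. linear_functional (\<lambda>x. F x y)" "\<And>x. linear_functional (F x)"
    and K: "\<And>x y. cmod (F x y) \<le> K * (norm x * norm y)"
    using assms unfolding bounded_bilinear_form_def by blast
  have "cmod (F x (y * b)) \<le> (max K 0 * norm b) * (norm x * norm y)" for x y
  proof -
    have "cmod (F x (y * b)) \<le> K * (norm x * norm (y * b))" by (rule K)
    also have "\<dots> \<le> max K 0 * (norm x * norm (y * b))" by (intro mult_right_mono) auto
    also have "\<dots> \<le> max K 0 * (norm x * (norm y * norm b))"
      by (intro mult_left_mono norm_mult_ineq) auto
    finally show ?thesis by (simp add: mult_ac)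
  qed
  thus ?thesis using lin unfolding bounded_bilinear_form_def
    by (auto simp: linear_functional_def distrib_right mult_scaleC_left)
qed

text \<open>Both actions are slices of the bilinear form \<open>f (a * b)\<close>, in its first and
  in its second argument.\<close>

lemma act_dual:
  assumes "f \<in> dual"
  shows act_right_dual: "f \<cdot>\<^sub>r a \<in> dual" and act_left_dual: "a \<cdot>\<^sub>l f \<in> dual"
  unfolding act_right_def act_left_def
  using bounded_bilinear_form_dual[OF bounded_bilinear_form_times[OF assms], of a]
    bounded_bilinear_form_dual[OF
      bounded_bilinear_form_swap[OF bounded_bilinear_form_times[OF assms]], of a]
  by simp_all

section \<open>Elementary tensors\<close>

lemma tensor_add_left: "(a + a') \<otimes> b = a \<otimes> b + a' \<otimes> b"
proof -
  have "alg_tensor_pure (a + a') b = alg_tensor_pure a b + alg_tensor_pure a' b"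
    using tensor_eq.add_left[of a a' b]
    by (simp add: alg_tensor_pure.abs_eq plus_alg_tensor.abs_eq alg_tensor.abs_eq_iff add_mset_commute)
  thus ?thesis by (simp add: tensor_def of_alg_tensor_add)
qed

lemma tensor_add_right: "a \<otimes> (b + b') = a \<otimes> b + a \<otimes> b'"
proof -
  have "alg_tensor_pure a (b + b') = alg_tensor_pure a b + alg_tensor_pure a b'"
    using tensor_eq.add_right[of a b b']
    by (simp add: alg_tensor_pure.abs_eq plus_alg_tensor.abs_eq alg_tensor.abs_eq_iff add_mset_commute)
  thus ?thesis by (simp add: tensor_def of_alg_tensor_add)
qed

lemma tensor_scaleC_left: "(c *\<^sub>C a) \<otimes> b = c *\<^sub>C (a \<otimes> b)"
proof -
  have "alg_tensor_pure (c *\<^sub>C a) b = c *\<^sub>C alg_tensor_pure a b"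
    by (simp add: alg_tensor_pure.abs_eq scaleC_alg_tensor.abs_eq)
  thus ?thesis by (simp add: tensor_def of_alg_tensor_scaleC)
qed

text \<open>Scalars act on the left factor by definition; the relation
  \<open>tensor_eq.scale\<close> carries them across.\<close>

lemma tensor_scaleC_right: "a \<otimes> (c *\<^sub>C b) = c *\<^sub>C (a \<otimes> b)"
proof -
  have "alg_tensor_pure (c *\<^sub>C a) b = alg_tensor_pure a (c *\<^sub>C b)"
    using tensor_eq.scale[of c a b] by (simp add: alg_tensor_pure.abs_eq alg_tensor.abs_eq_iff)
  thus ?thesis by (simp add: tensor_def tensor_scaleC_left[unfolded tensor_def, symmetric])
qed

lemma bounded_bilinear_form_tensor:
  "h \<in> dual \<Longrightarrow> bounded_bilinear_form (\<lambda>a b. h (a \<otimes> b))"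
  by (rule bounded_bilinear_form_compose)
     (simp_all add: tensor_add_left tensor_add_right tensor_scaleC_left tensor_scaleC_right norm_tensor_le)

text \<open>The bound on elementary tensors sums to \<open>C\<close> times the cost of any
  representation; the infimum over representations gives the projective norm, and limits give the
  completion. The explicit constant makes \<open>f \<otimes>\<^sub>f g\<close> bounded in terms of
  \<open>onorm f\<close>.\<close>

lemma dual_tensor_bound:
  fixes h :: "('a::complex_banach_algebra, 'b::complex_banach_algebra) proj_tensor \<Rightarrow> complex"
  assumes h: "h \<in> dual" and C: "C \<ge> 0" and le: "\<And>a b. cmod (h (a \<otimes> b)) \<le> C * (norm a * norm b)"
  shows "cmod (h U) \<le> C * norm U"
proof -
  have cost: "cmod (h (\<Sum>(a, b)\<in>#M. a \<otimes> b)) \<le> C * mset_cost M" for M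
  proof (induction M)
    case empty show ?case using linear_functional_zero[OF dual_linear[OF h]] by simp
  next
    case (add x M)
    obtain a b where x: "x = (a, b)" by (cases x)
    have "cmod (h (a \<otimes> b + (\<Sum>(a, b)\<in>#M. a \<otimes> b)))
        \<le> cmod (h (a \<otimes> b)) + cmod (h (\<Sum>(a, b)\<in>#M. a \<otimes> b))"
      using dual_linear[OF h] by (simp add: linear_functional_def norm_triangle_ineq)
    thus ?case using add le[of a b] by (simp add: x algebra_simps)
  qed
  have alg: "cmod (h (of_alg_tensor u)) \<le> C * proj_norm u" for u
  proof (rule field_le_epsilon)
    fix e :: real assume e: "e > 0"
    \<comment> \<open>Division by \<open>C + 1\<close>, because \<open>C\<close> may be 0.\<close>
    hence pos: "e / (C + 1) > 0" using C by simp
    obtain M where M: "abs_alg_tensor M = u" "mset_cost M < proj_norm u + e / (C + 1)"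
      using proj_norm_approx[OF pos, of u] by auto
    have "cmod (h (of_alg_tensor u)) \<le> C * mset_cost M"
      using cost[of M] by (simp add: M(1)[symmetric] of_alg_tensor_sum)
    also have "\<dots> \<le> C * (proj_norm u + e / (C + 1))" using M(2) C by (intro mult_left_mono) auto
    also have "\<dots> \<le> C * proj_norm u + e" using C e by (simp add: field_simps)
    finally show "cmod (h (of_alg_tensor u)) \<le> C * proj_norm u + e" .
  qed
  obtain X where U: "U = abs_proj_tensor X" and X: "proj_Cauchy X" by (rule proj_tensor_cases)
  show ?thesis unfolding U
  proof (rule LIMSEQ_le)
    show "(\<lambda>n. cmod (h (of_alg_tensor (X n)))) \<longlonglongrightarrow> cmod (h (abs_proj_tensor X))"
      by (intro tendsto_norm dual_tendsto[OF h] proj_tensor_limit X)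
    show "(\<lambda>n. C * proj_norm (X n)) \<longlonglongrightarrow> C * norm (abs_proj_tensor X)"
      by (intro tendsto_intros norm_proj_tensor_tendsto X)
    show "\<exists>N. \<forall>n\<ge>N. cmod (h (of_alg_tensor (X n))) \<le> C * proj_norm (X n)" using alg by blast
  qed
qed

section \<open>Inner amenability of the factors\<close>

lemma gelfand_spectrum_one:
  assumes "\<phi> \<in> gelfand_spectrum"
  obtains a where "\<phi> a = 1"
proof -
  obtain a where "\<phi> a \<noteq> 0" and lin: "linear_functional \<phi>"
    using assms unfolding gelfand_spectrum_def by blast
  hence "\<phi> (inverse (\<phi> a) *\<^sub>C a) = 1" by (simp add: linear_functional_def)
  thus thesis by (rule that)
qed

text \<open>The witness is \<open>m\<close> composed with \<open>T\<close>. Since \<open>T\<close>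
  intertwines the actions of \<open>a\<close> with those of \<open>j a\<close>, invariance of
  \<open>m\<close> at \<open>j a\<close> becomes invariance at \<open>a\<close>. Used for both
  factors of the tensor product.\<close>

lemma inner_amenable_pullback:
  fixes T :: "('a::complex_banach_algebra \<Rightarrow> complex) \<Rightarrow> 'c::complex_banach_algebra \<Rightarrow> complex"
  assumes amen: "inner_amenable \<omega>"
    and T: "\<And>f. f \<in> dual \<Longrightarrow> T f \<in> dual"
    and add: "\<And>f g. f \<in> dual \<Longrightarrow> g \<in> dual \<Longrightarrow> T (\<lambda>x. f x + g x) = (\<lambda>u. T f u + T g u)"
    and scale: "\<And>c f. f \<in> dual \<Longrightarrow> T (\<lambda>x. c * f x) = (\<lambda>u. c * T f u)"
    and C: "C \<ge> 0" and bound: "\<And>f u. f \<in> dual \<Longrightarrow> cmod (T f u) \<le> (C * onorm f) * norm u"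
    and T_\<phi>: "T \<phi> = \<omega>"
    and act: "\<And>f a. f \<in> dual \<Longrightarrow> T (f \<cdot>\<^sub>r a) = T f \<cdot>\<^sub>r j a" "\<And>f a. f \<in> dual \<Longrightarrow> T (a \<cdot>\<^sub>l f) = j a \<cdot>\<^sub>l T f"
  shows "inner_amenable \<phi>"
proof -
  obtain m where m: "m \<in> bidual" "m \<omega> = 1" "\<And>f u. f \<in> dual \<Longrightarrow> m (f \<cdot>\<^sub>r u) = m (u \<cdot>\<^sub>l f)"
    using amen by (auto simp: inner_amenable_def)
  obtain K where K: "K \<ge> 0" "\<And>f C. f \<in> dual \<Longrightarrow> C \<ge> 0 \<Longrightarrow>
      (\<And>x. cmod (f x) \<le> C * norm x) \<Longrightarrow> cmod (m f) \<le> K * C"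
    using bidual_bound[OF m(1)] by metis
  have "cmod (m (T f)) \<le> (K * C) * onorm f" if f: "f \<in> dual" for f
    using K(2)[OF T[OF f] _ bound[OF f]] C onorm_dual_nonneg[OF f] by (simp add: mult.assoc)
  hence "(\<lambda>f. m (T f)) \<in> bidual"
    unfolding bidual_def using T by (auto simp: add scale bidual_add[OF m(1)] bidual_scale[OF m(1)])
  thus ?thesis unfolding inner_amenable_def
    by (rule bexI[rotated]) (simp add: T_\<phi> m T act)
qed

lemma tensor_functional_bound:
  assumes "f \<in> dual" "g \<in> dual"
  shows "cmod ((f \<otimes>\<^sub>f g) U) \<le> (onorm f * onorm g) * norm U"
proof (rule dual_tensor_bound)
  show "cmod ((f \<otimes>\<^sub>f g) (a \<otimes> b)) \<le> onorm f * onorm g * (norm a * norm b)" for a b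
    using mult_mono[OF onorm_dual[OF assms(1), of a] onorm_dual[OF assms(2), of b]]
      onorm_dual_nonneg[OF assms(1)]
    by (simp add: tensor_functional(2)[OF assms] norm_mult algebra_simps)
qed (simp_all add: assms tensor_functional onorm_dual_nonneg)

lemma inner_amenable_tensor_left:
  fixes \<phi> :: "'a::complex_banach_algebra \<Rightarrow> complex" and \<psi> :: "'b::complex_banach_algebra \<Rightarrow> complex"
  assumes \<psi>: "\<psi> \<in> gelfand_spectrum" and amen: "inner_amenable (\<phi> \<otimes>\<^sub>f \<psi>)"
  shows "inner_amenable \<phi>"
proof -
  have \<psi>_dual: "\<psi> \<in> dual" using \<psi> gelfand_spectrum_subset_dual by blast
  have mult: "\<psi> (x * y) = \<psi> x * \<psi> y" for x y using \<psi> by (simp add: gelfand_spectrum_def)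
  obtain b where b: "\<psi> b = 1" using gelfand_spectrum_one[OF \<psi>] .
  note tf = tensor_functional[OF _ \<psi>_dual]
  show ?thesis
  proof (rule inner_amenable_pullback[where T = "\<lambda>f. f \<otimes>\<^sub>f \<psi>" and j = "\<lambda>a. a \<otimes> b", OF amen])
    show "cmod ((f \<otimes>\<^sub>f \<psi>) U) \<le> (onorm \<psi> * onorm f) * norm U" if "f \<in> dual"
      for f and U :: "('a, 'b) proj_tensor"
      using tensor_functional_bound[OF that \<psi>_dual] by (simp add: mult.commute)
    \<comment> \<open>At \<open>x \<otimes> y\<close> both sides are
      \<open>f (a * x) * \<psi> y\<close>, because
      \<open>\<psi> (b * y) = \<psi> b * \<psi> y = \<psi> y\<close>.\<close>
    show "(f \<cdot>\<^sub>r a) \<otimes>\<^sub>f \<psi> = (f \<otimes>\<^sub>f \<psi>) \<cdot>\<^sub>r (a \<otimes> b)" if "f \<in> dual" for f a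
      using that by (intro dual_tensor_eqI)
        (auto simp: tf act_dual,
         simp add: act_right_def tf act_right_dual[unfolded act_right_def] tensor_times mult b)
    show "(a \<cdot>\<^sub>l f) \<otimes>\<^sub>f \<psi> = (a \<otimes> b) \<cdot>\<^sub>l (f \<otimes>\<^sub>f \<psi>)" if "f \<in> dual" for f a
      using that by (intro dual_tensor_eqI)
        (auto simp: tf act_dual,
         simp add: act_left_def tf act_left_dual[unfolded act_left_def] tensor_times mult b)
  qed (auto intro!: dual_tensor_eqI dual_add dual_scale
      simp: tf dual_add dual_scale algebra_simps onorm_dual_nonneg \<psi>_dual)
qed

text \<open>The same pullback with the factors exchanged; the fixed element is now \<open>a\<close>
  with \<open>\<phi> a = 1\<close>.\<close>

lemma inner_amenable_tensor_right:
  fixes \<phi> :: "'a::complex_banach_algebra \<Rightarrow> complex" and \<psi> :: "'b::complex_banach_algebra \<Rightarrow> complex"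
  assumes \<phi>: "\<phi> \<in> gelfand_spectrum" and amen: "inner_amenable (\<phi> \<otimes>\<^sub>f \<psi>)"
  shows "inner_amenable \<psi>"
proof -
  have \<phi>_dual: "\<phi> \<in> dual" using \<phi> gelfand_spectrum_subset_dual by blast
  have mult: "\<phi> (x * y) = \<phi> x * \<phi> y" for x y using \<phi> by (simp add: gelfand_spectrum_def)
  obtain a where a: "\<phi> a = 1" using gelfand_spectrum_one[OF \<phi>] .
  note tf = tensor_functional[OF \<phi>_dual]
  show ?thesis
  proof (rule inner_amenable_pullback[where T = "\<lambda>g. \<phi> \<otimes>\<^sub>f g" and j = "\<lambda>b. a \<otimes> b", OF amen])
    show "cmod ((\<phi> \<otimes>\<^sub>f g) U) \<le> (onorm \<phi> * onorm g) * norm U" if "g \<in> dual"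
      for g and U :: "('a, 'b) proj_tensor"
      using tensor_functional_bound[OF \<phi>_dual that] .
    show "\<phi> \<otimes>\<^sub>f (g \<cdot>\<^sub>r b) = (\<phi> \<otimes>\<^sub>f g) \<cdot>\<^sub>r (a \<otimes> b)" if "g \<in> dual" for g b
      using that by (intro dual_tensor_eqI)
        (auto simp: tf act_dual,
         simp add: act_right_def tf act_right_dual[unfolded act_right_def] tensor_times mult a)
    show "\<phi> \<otimes>\<^sub>f (b \<cdot>\<^sub>l g) = (a \<otimes> b) \<cdot>\<^sub>l (\<phi> \<otimes>\<^sub>f g)" if "g \<in> dual" for g b
      using that by (intro dual_tensor_eqI)
        (auto simp: tf act_dual,
         simp add: act_left_def tf act_left_dual[unfolded act_left_def] tensor_times mult a)
  qed (auto intro!: dual_tensor_eqI dual_add dual_scale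
      simp: tf dual_add dual_scale algebra_simps onorm_dual_nonneg \<phi>_dual)
qed

section \<open>Inner amenability of the tensor product\<close>

text \<open>One of two natural extensions of the product functional: for bidual \<open>m\<close>,
  \<open>n\<close> its value at \<open>f \<otimes>\<^sub>f g\<close> is \<open>m f * n g\<close>.
  Applying \<open>m\<close> first may give a different functional.\<close>

definition bidual_tensor ::
    "(('a::complex_banach_algebra \<Rightarrow> complex) \<Rightarrow> complex) \<Rightarrow> (('b::complex_banach_algebra \<Rightarrow> complex) \<Rightarrow> complex)
     \<Rightarrow> (('a, 'b) proj_tensor \<Rightarrow> complex) \<Rightarrow> complex" where
  "bidual_tensor m n h = m (\<lambda>a. n (\<lambda>b. h (a \<otimes> b)))"

lemma bidual_tensor:
  assumes m: "m \<in> bidual" and n: "n \<in> bidual"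
  shows "bidual_tensor m n \<in> bidual"
proof -
  obtain K where K: "K \<ge> 0" "\<And>f C. f \<in> dual \<Longrightarrow> C \<ge> 0 \<Longrightarrow>
      (\<And>x. cmod (f x) \<le> C * norm x) \<Longrightarrow> cmod (m f) \<le> K * C"
    using bidual_bound[OF m] by metis
  obtain L where L: "L \<ge> 0" "\<And>f C. f \<in> dual \<Longrightarrow> C \<ge> 0 \<Longrightarrow>
      (\<And>x. cmod (f x) \<le> C * norm x) \<Longrightarrow> cmod (n f) \<le> L * C"
    using bidual_bound[OF n] by metis
  note slice = bounded_bilinear_form_dual[OF bounded_bilinear_form_tensor]
  note iter = bidual_bilinear[OF n bounded_bilinear_form_tensor]
  have "cmod (bidual_tensor m n h) \<le> (K * L) * onorm h" if h: "h \<in> dual" for h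
  proof -
    have le: "cmod (h (a \<otimes> b)) \<le> (onorm h * norm a) * norm b" for a b
      using onorm_dual[OF h, of "a \<otimes> b"]
        mult_left_mono[OF norm_tensor_le[of a b] onorm_dual_nonneg[OF h]]
      by (simp add: mult.assoc)
    have "cmod (n (\<lambda>b. h (a \<otimes> b))) \<le> (L * onorm h) * norm a" for a
      using L(2)[OF slice[OF h] _ le] onorm_dual_nonneg[OF h] by (simp add: mult.assoc)
    from K(2)[OF iter[OF h] _ this] show ?thesis
      using L(1) onorm_dual_nonneg[OF h] by (simp add: bidual_tensor_def mult.assoc)
  qed
  thus ?thesis unfolding bidual_def
    by (auto simp: bidual_tensor_def slice iter bidual_add[OF m] bidual_add[OF n]
        bidual_scale[OF m] bidual_scale[OF n])
qed

lemma bidual_tensor_invariant: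
  assumes m: "m \<in> bidual" "\<And>f a. f \<in> dual \<Longrightarrow> m (f \<cdot>\<^sub>r a) = m (a \<cdot>\<^sub>l f)"
    and n: "n \<in> bidual" "\<And>g b. g \<in> dual \<Longrightarrow> n (g \<cdot>\<^sub>r b) = n (b \<cdot>\<^sub>l g)"
    and h: "h \<in> dual"
  shows "bidual_tensor m n (h \<cdot>\<^sub>r U) = bidual_tensor m n (U \<cdot>\<^sub>l h)"
proof -
  note bt = bidual_tensor[OF m(1) n(1)]
  have pure: "bidual_tensor m n (h \<cdot>\<^sub>r (a \<otimes> b)) = bidual_tensor m n ((a \<otimes> b) \<cdot>\<^sub>l h)" for a b
  proof -
    \<comment> \<open>The functional to which invariance of \<open>m\<close> at \<open>a\<close> is
      applied, once \<open>b\<close> stands on the right.\<close>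
    have F: "(\<lambda>x. n (\<lambda>y. h (x \<otimes> (y * b)))) \<in> dual"
      by (rule bidual_bilinear[OF n(1) bounded_bilinear_form_times_right[OF bounded_bilinear_form_tensor[OF h]]])
    \<comment> \<open>Invariance of \<open>n\<close> at \<open>b\<close>, for the slice of
      \<open>h\<close> at \<open>a * x\<close>.\<close>
    have "n (\<lambda>y. h ((a * x) \<otimes> (b * y))) = n (\<lambda>y. h ((a * x) \<otimes> (y * b)))" for x
      using n(2)[OF bounded_bilinear_form_dual[OF bounded_bilinear_form_tensor[OF h]], of "a * x" b]
      by (simp add: act_right_def act_left_def)
    hence "bidual_tensor m n (h \<cdot>\<^sub>r (a \<otimes> b)) = m (\<lambda>x. n (\<lambda>y. h ((a * x) \<otimes> (y * b))))"
      by (simp add: bidual_tensor_def act_right_def tensor_times)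
    also have "\<dots> = m (\<lambda>x. n (\<lambda>y. h ((x * a) \<otimes> (y * b))))"
      using m(2)[OF F, of a] by (simp add: act_right_def act_left_def)
    finally show ?thesis by (simp add: bidual_tensor_def act_left_def tensor_times)
  qed
  \<comment> \<open>For fixed \<open>h\<close> both sides are bounded and linear in
    \<open>U\<close>, so elementary tensors decide.\<close>
  have "(\<lambda>U. bidual_tensor m n (h \<cdot>\<^sub>r U)) = (\<lambda>U. bidual_tensor m n (U \<cdot>\<^sub>l h))"
  proof (rule dual_tensor_eqI)
    show "(\<lambda>U. bidual_tensor m n (h \<cdot>\<^sub>r U)) \<in> dual"
      unfolding act_right_def by (rule bidual_bilinear[OF bt bounded_bilinear_form_times[OF h]])
    show "(\<lambda>U. bidual_tensor m n (U \<cdot>\<^sub>l h)) \<in> dual"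
      unfolding act_left_def
      by (rule bidual_bilinear[OF bt bounded_bilinear_form_swap[OF bounded_bilinear_form_times[OF h]]])
  qed (rule pure)
  thus ?thesis by (rule fun_cong)
qed

lemma inner_amenable_tensor:
  assumes \<phi>: "\<phi> \<in> dual" "inner_amenable \<phi>" and \<psi>: "\<psi> \<in> dual" "inner_amenable \<psi>"
  shows "inner_amenable (\<phi> \<otimes>\<^sub>f \<psi>)"
proof -
  obtain m where m: "m \<in> bidual" "\<And>f a. f \<in> dual \<Longrightarrow> m (f \<cdot>\<^sub>r a) = m (a \<cdot>\<^sub>l f)" "m \<phi> = 1"
    using \<phi>(2) by (auto simp: inner_amenable_def)
  obtain n where n: "n \<in> bidual" "\<And>g b. g \<in> dual \<Longrightarrow> n (g \<cdot>\<^sub>r b) = n (b \<cdot>\<^sub>l g)" "n \<psi> = 1"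
    using \<psi>(2) by (auto simp: inner_amenable_def)
  have "bidual_tensor m n (\<phi> \<otimes>\<^sub>f \<psi>) = 1"
    by (simp add: bidual_tensor_def tensor_functional(2)[OF \<phi>(1) \<psi>(1)] bidual_scale[OF n(1) \<psi>(1)] m n)
  thus ?thesis unfolding inner_amenable_def
    using bidual_tensor[OF m(1) n(1)] bidual_tensor_invariant[OF m(1,2) n(1,2)] by blast
qed

section \<open>Characters of the tensor product\<close>

text \<open>Multiplicativity holds on elementary tensors and extends one argument at a time: with
  the other argument fixed, both sides are bounded functionals.\<close>

lemma tensor_functional_gelfand_spectrum:
  fixes \<phi> :: "'a::complex_banach_algebra \<Rightarrow> complex" and \<psi> :: "'b::complex_banach_algebra \<Rightarrow> complex"
  assumes \<phi>: "\<phi> \<in> gelfand_spectrum" and \<psi>: "\<psi> \<in> gelfand_spectrum"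
  shows "\<phi> \<otimes>\<^sub>f \<psi> \<in> gelfand_spectrum"
proof -
  have dual: "\<phi> \<in> dual" "\<psi> \<in> dual" using \<phi> \<psi> gelfand_spectrum_subset_dual by blast+
  have mult: "\<phi> (x * y) = \<phi> x * \<phi> y" "\<psi> (z * w) = \<psi> z * \<psi> w" for x y z w
    using \<phi> \<psi> by (simp_all add: gelfand_spectrum_def)
  define h where "h = \<phi> \<otimes>\<^sub>f \<psi>"
  have h: "h \<in> dual" "h (a \<otimes> b) = \<phi> a * \<psi> b" for a b
    by (simp_all add: h_def tensor_functional dual)
  note right = bounded_bilinear_form_dual[OF bounded_bilinear_form_times[OF h(1)]]
  note left = bounded_bilinear_form_dual[OF bounded_bilinear_form_swap[OF bounded_bilinear_form_times[OF h(1)]]]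
  have "(\<lambda>V. h ((a \<otimes> b) * V)) = (\<lambda>V. h (a \<otimes> b) * h V)" for a b
    by (intro dual_tensor_eqI right dual_scale h) (simp add: tensor_times h mult)
  hence pure: "h ((a \<otimes> b) * V) = h (a \<otimes> b) * h V" for a b V by (rule fun_cong)
  \<comment> \<open>The constant \<open>h V\<close> comes first to match \<open>dual_scale\<close>;
    commutativity restores the order below.\<close>
  have "(\<lambda>U. h (U * V)) = (\<lambda>U. h V * h U)" for V
    by (intro dual_tensor_eqI left dual_scale h) (simp add: pure mult.commute)
  hence "h (U * V) = h V * h U" for U V by (rule fun_cong)
  hence "h (U * V) = h U * h V" for U V by (simp add: mult.commute)
  moreover obtain a b where "\<phi> a = 1" "\<psi> b = 1"
    using gelfand_spectrum_one[OF \<phi>] gelfand_spectrum_one[OF \<psi>] by metis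
  hence "h (a \<otimes> b) = 1" by (simp add: h)
  hence "h \<noteq> (\<lambda>_. 0)" by auto
  ultimately show ?thesis using dual_linear[OF h(1)] by (simp add: gelfand_spectrum_def h_def)
qed

lemma gelfand_spectrum_tensor:
  fixes h :: "('a::complex_banach_algebra, 'b::complex_banach_algebra) proj_tensor \<Rightarrow> complex"
  assumes h: "h \<in> gelfand_spectrum"
  obtains \<phi> \<psi> where "\<phi> \<in> gelfand_spectrum" "\<psi> \<in> gelfand_spectrum" "h = \<phi> \<otimes>\<^sub>f \<psi>"
proof -
  have h_dual: "h \<in> dual" using h gelfand_spectrum_subset_dual by blast
  have lin: "h (U + V) = h U + h V" "h (c *\<^sub>C U) = c * h U" and mult: "h (U * V) = h U * h V" for U V c
    using h by (simp_all add: gelfand_spectrum_def linear_functional_def)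
  have "\<exists>a b. h (a \<otimes> b) \<noteq> 0"
  proof (rule ccontr)
    assume "\<not> ?thesis"
    \<comment> \<open>The zero functional, written so that \<open>dual_scale\<close> puts it in
      \<open>dual\<close>.\<close>
    hence "h = (\<lambda>U. 0 * h U)" by (intro dual_tensor_eqI h_dual dual_scale) simp
    thus False using h by (simp add: gelfand_spectrum_def)
  qed
  then obtain u0 v where "h (u0 \<otimes> v) \<noteq> 0" by blast
  hence "h ((inverse (h (u0 \<otimes> v)) *\<^sub>C u0) \<otimes> v) = 1" by (simp add: tensor_scaleC_left lin)
  then obtain u where uv: "h (u \<otimes> v) = 1" by blast
  \<comment> \<open>With units, \<open>h (a \<otimes> 1)\<close> would do; here
    \<open>u \<otimes> v\<close>, where \<open>h\<close> is 1, stands in for the unit.\<close>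
  define \<phi> where "\<phi> a = h ((a * u) \<otimes> v)" for a
  define \<psi> where "\<psi> b = h (u \<otimes> (b * v))" for b
  have ht: "h ((a * c) \<otimes> (b * d)) = h (a \<otimes> b) * h (c \<otimes> d)" for a b c d
    by (simp add: mult tensor_times[symmetric])
  \<comment> \<open>The tensor \<open>(u * a * u) \<otimes> (v * v)\<close> is split before and
    after \<open>a\<close>.\<close>
  have \<phi>_left: "h ((u * a) \<otimes> v) = \<phi> a" for a
    using ht[of "u * a" u v v] ht[of u "a * u" v v] by (simp add: \<phi>_def uv mult.assoc)
  have \<psi>_left: "h (u \<otimes> (v * b)) = \<psi> b" for b
    using ht[of u u "v * b" v] ht[of u u v "b * v"] by (simp add: \<psi>_def uv mult.assoc)
  \<comment> \<open>Splitting \<open>(u * a * c * u) \<otimes> (v * v)\<close> between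
    \<open>a\<close> and \<open>c\<close> gives \<open>\<phi> a * \<phi> c\<close>, splitting after
    the first \<open>u\<close> gives \<open>\<phi> (a * c)\<close>.\<close>
  have \<phi>_mult: "\<phi> (a * c) = \<phi> a * \<phi> c" for a c
    using ht[of "u * a" "c * u" v v] ht[of u "a * c * u" v v]
    by (simp add: \<phi>_left uv mult.assoc) (simp add: \<phi>_def mult.assoc)
  have \<psi>_mult: "\<psi> (b * d) = \<psi> b * \<psi> d" for b d
    using ht[of u u "v * b" "d * v"] ht[of u u v "b * d * v"]
    by (simp add: \<psi>_left uv mult.assoc) (simp add: \<psi>_def mult.assoc)
  have fac: "h (a \<otimes> b) = \<phi> a * \<psi> b" for a b
  proof -
    \<comment> \<open>Sandwiching yields \<open>(u * a * u) \<otimes> (v * b * v)\<close>, which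
      regroups so that \<open>a\<close> and \<open>b\<close> lie in different factors.\<close>
    have "h (a \<otimes> b) = h (u \<otimes> v) * h (a \<otimes> b) * h (u \<otimes> v)" by (simp add: uv)
    also have "\<dots> = h ((u * a) \<otimes> v) * h (u \<otimes> (b * v))"
      by (simp add: ht[symmetric] mult.assoc)
    finally show ?thesis by (simp add: \<phi>_left \<psi>_def)
  qed
  have nz: "\<phi> u * \<psi> v = 1" using fac[of u v] uv by simp
  hence "\<phi> \<noteq> (\<lambda>_. 0)" "\<psi> \<noteq> (\<lambda>_. 0)" by auto
  moreover have "linear_functional \<phi>" "linear_functional \<psi>"
    by (simp_all add: linear_functional_def \<phi>_def \<psi>_def distrib_right mult_scaleC_left tensor_add_left
        tensor_add_right tensor_scaleC_left tensor_scaleC_right lin)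
  ultimately have spec: "\<phi> \<in> gelfand_spectrum" "\<psi> \<in> gelfand_spectrum"
    by (simp_all add: gelfand_spectrum_def \<phi>_mult \<psi>_mult)
  hence "\<phi> \<in> dual" "\<psi> \<in> dual" using gelfand_spectrum_subset_dual by blast+
  hence "h = \<phi> \<otimes>\<^sub>f \<psi>" by (intro dual_tensor_eqI h_dual) (simp_all add: tensor_functional fac)
  with spec show thesis by (rule that)
qed

section \<open>The equivalence and its consequence for all characters\<close>

lemma inner_amenable_tensor_iff:
  assumes "\<phi> \<in> gelfand_spectrum" and "\<psi> \<in> gelfand_spectrum"
  shows "inner_amenable (\<phi> \<otimes>\<^sub>f \<psi>) \<longleftrightarrow> inner_amenable \<phi> \<and> inner_amenable \<psi>"
  using assms gelfand_spectrum_subset_dual inner_amenable_tensor_left inner_amenable_tensor_right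
    inner_amenable_tensor by (metis subsetD)

theorem theorem3p1:
  fixes \<phi> :: "'a::complex_banach_algebra \<Rightarrow> complex"
    and \<psi> :: "'b::complex_banach_algebra \<Rightarrow> complex"
  assumes "\<phi> \<in> gelfand_spectrum" and "\<psi> \<in> gelfand_spectrum"
  shows "(inner_amenable (\<phi> \<otimes>\<^sub>f \<psi>) \<longleftrightarrow> inner_amenable \<phi> \<and> inner_amenable \<psi>)
    \<and> (character_inner_amenable TYPE(('a, 'b) proj_tensor) \<longleftrightarrow>
        character_inner_amenable TYPE('a) \<and> character_inner_amenable TYPE('b))"
proof (intro conjI iffI)
  assume tensor: "character_inner_amenable TYPE(('a, 'b) proj_tensor)"
  \<comment> \<open>Each character of the first algebra is tensored with the given
    \<open>\<psi>\<close>. If the second algebra had no character, neither would the tensor product,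
    and its character inner amenability would hold vacuously.\<close>
  show "character_inner_amenable TYPE('a)"
    unfolding character_inner_amenable_def
    using tensor assms(2) tensor_functional_gelfand_spectrum inner_amenable_tensor_iff
    by (metis character_inner_amenable_def)
  show "character_inner_amenable TYPE('b)"
    unfolding character_inner_amenable_def
    using tensor assms(1) tensor_functional_gelfand_spectrum inner_amenable_tensor_iff
    by (metis character_inner_amenable_def)
next
  assume "character_inner_amenable TYPE('a) \<and> character_inner_amenable TYPE('b)"
  thus "character_inner_amenable TYPE(('a, 'b) proj_tensor)"
    unfolding character_inner_amenable_def
    by (metis gelfand_spectrum_tensor inner_amenable_tensor_iff)
qed (use inner_amenable_tensor_iff[OF assms] in blast)+

end
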